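(* Let $A\in\mathbb{R}^{r\times s}$, $B\in\mathbb{R}^{r\times m}$, $C\in\mathbb{R}^{n\times s}$, $c\in\mathbb{R}$, $\mu\ge 0$; put $q=\min\{m,n\}$, $r_b=\mathrm{rank}(B)$, $r_c=\mathrm{rank}(C)$. Let $\|\cdot\|_{\rm UI}$ be a unitarily invariant norm on $\mathbb{R}^{r\times s}$. Assume: (i) $F$ and $G$ are spectral functions on $\mathbb{R}^{m\times n}$, $F(X)=f(\sigma(X))$ and $G(X)=g(\sigma(X))$, with $f,g:\mathbb{R}^q\to(-\infty,\infty]$ proper and absolutely symmetric; (ii) $\ell:\mathbb{R}_+\to(-\infty,\infty]$ is proper and non-decreasing; (iii) $f$ and $g$ are monotone under weak majorization on $\mathbb{R}^q_+$; (iv) $(I-P_B)AP_C=0$ and $P_BA(I-P_C)=0$, where $P_B$ and $P_C$ are the orthogonal projectors onto the column space of $B$ and the row space of $C$, respectively; (v) there exist thin SVDs $B=U_B\Sigma_BV_B^T$ and $C=U_C\Sigma_CV_C^T$ such that $\widetilde A:=U_B^TAV_C\in\mathbb{R}^{r_b\times r_c}$ is generalized diagonal, i.e. $\widetilde A_{ij}=0$ for $i\neq j$. Fix such a pair of thin SVDs. If the problem $$\min_{X\in\mathbb{R}^{m\times n}}\ \ell(\|A-BXC\|_{\rm UI})+\mu F(X)\quad\text{s.t.}\quad G(X)\le c$$ admits an optimal solution, then it admits an optimal solution of the form $X^*=V_B\Sigma U_C^T$, where $\Sigma\in\mathbb{R}^{r_b\times r_c}$ is a generalized diagonal matrix (i.e.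 $\Sigma_{ij}=0$ for $i\ne j$).
   Context: $\sigma(X)$ is the vector of singular values of a matrix $X$ in non-increasing order (of length the minimum of its dimensions). $\mathbb{R}_+=[0,\infty)$. Thin SVDs: $U_B\in\mathbb{R}^{r\times r_b}$, $V_B\in\mathbb{R}^{m\times r_b}$, $U_C\in\mathbb{R}^{n\times r_c}$, $V_C\in\mathbb{R}^{s\times r_c}$ have orthonormal columns, and $\Sigma_B\in\mathbb{R}^{r_b\times r_b}$, $\Sigma_C\in\mathbb{R}^{r_c\times r_c}$ are diagonal with the positive singular values on the diagonal in non-increasing order. A function is proper if it never takes the value $-\infty$ and is not identically $+\infty$. A proper $f:\mathbb{R}^q\to(-\infty,\infty]$ is absolutely symmetric if $f(PJx)=f(x)$ for every $x$, every permutation matrix $P$ and every diagonal $J$ with $J_{ii}\in\{\pm1\}$. For $x,y\in\mathbb{R}^q$, $x\prec_w y$ (weak majorization) means $\sum_{i=1}^kx_{[i]}\le\sum_{i=1}^ky_{[i]}$ for $k=1,\dots,q$, where $x_{[1]}\ge\dots\ge x_{[q]}$ are the components in non-increasing order. $f$ is monotone under weak majorization on $\mathbb{R}^q_+$ if for all $x,y\in\mathbb{R}^q_+$, $x\prec_wy$ implies $f(x)\le f(y)$. A norm on $\mathbb{R}^{r\times s}$ is unitarily invariant if $\|UZV^T\|=\|Z\|$ for all $Z$ and all orthogonal $U\in\mathbb{R}^{r\times r},V\in\mathbb{R}^{s\times s}$. An optimal solution is a feasible point whose objective value is no larger than that of any other feasible point. *)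

theory Defs
  imports
    "HOL-Library.Extended_Real"
    "Jordan_Normal_Form.DL_Rank"
    "Jordan_Normal_Form.Char_Poly"
begin

definition descending :: "real list \<Rightarrow> real list" where
  "descending xs = rev (sort xs)"

text \<open>
  The singular values of \<open>X\<close> are the square roots of the eigenvalues of \<open>X\<^sup>T X\<close>, counted with
  their multiplicity as roots of the characteristic polynomial. Since \<open>X\<^sup>T X\<close> is symmetric and
  positive semidefinite there are \<open>dim_col X\<close> of them, and those beyond the first
  \<open>min (dim_row X) (dim_col X)\<close> vanish.
\<close>
definition singular_values :: "real mat \<Rightarrow> real vec" where
  "singular_values X = vec_of_list (take (min (dim_row X) (dim_col X))
     (rev (sorted_list_of_multiset (image_mset sqrt (proots (char_poly (X\<^sup>T * X)))))))"

definition orthonormal_cols :: "real mat \<Rightarrow> bool" where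
  "orthonormal_cols U \<longleftrightarrow> U\<^sup>T * U = 1\<^sub>m (dim_col U)"

definition orthogonal_matrix :: "nat \<Rightarrow> real mat \<Rightarrow> bool" where
  "orthogonal_matrix k U \<longleftrightarrow> U \<in> carrier_mat k k \<and> orthonormal_cols U"

text \<open>\<open>thin_svd k X U S V\<close>: \<open>X = U S V\<^sup>T\<close> is a thin SVD with inner dimension \<open>k\<close>.\<close>
definition thin_svd :: "nat \<Rightarrow> real mat \<Rightarrow> real mat \<Rightarrow> real mat \<Rightarrow> real mat \<Rightarrow> bool" where
  "thin_svd k X U S V \<longleftrightarrow>
     U \<in> carrier_mat (dim_row X) k \<and> orthonormal_cols U \<and>
     V \<in> carrier_mat (dim_col X) k \<and> orthonormal_cols V \<and>
     S \<in> carrier_mat k k \<and> diagonal_mat S \<and>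
     diag_mat S = filter (\<lambda>x. 0 < x) (list_of_vec (singular_values X)) \<and>
     X = U * S * V\<^sup>T"

definition orthogonal_projector :: "nat \<Rightarrow> real vec set \<Rightarrow> real mat \<Rightarrow> bool" where
  "orthogonal_projector d W P \<longleftrightarrow> P \<in> carrier_mat d d \<and>
     (\<forall>x \<in> carrier_vec d. P *\<^sub>v x \<in> W \<and> (\<forall>w \<in> W. (x - P *\<^sub>v x) \<bullet> w = 0))"

text \<open>An extended-real function on \<open>D\<close> is encoded as a total HOL function; its values outside
  \<open>D\<close> are irrelevant.\<close>
definition proper_on :: "'a set \<Rightarrow> ('a \<Rightarrow> ereal) \<Rightarrow> bool" where
  "proper_on D f \<longleftrightarrow> (\<forall>x \<in> D. f x \<noteq> -\<infinity>) \<and> (\<exists>x \<in> D. f x \<noteq> \<infinity>)"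

definition permutation_matrix :: "nat \<Rightarrow> real mat \<Rightarrow> bool" where
  "permutation_matrix q P \<longleftrightarrow>
     (\<exists>p. p permutes {..<q} \<and> P = mat q q (\<lambda>(i, j). if j = p i then 1 else 0))"

definition sign_matrix :: "nat \<Rightarrow> real mat \<Rightarrow> bool" where
  "sign_matrix q J \<longleftrightarrow> J \<in> carrier_mat q q \<and> diagonal_mat J \<and> (\<forall>i<q. J $$ (i, i) \<in> {1, -1})"

definition absolutely_symmetric :: "nat \<Rightarrow> (real vec \<Rightarrow> ereal) \<Rightarrow> bool" where
  "absolutely_symmetric q f \<longleftrightarrow>
     (\<forall>x \<in> carrier_vec q. \<forall>P J. permutation_matrix q P \<and> sign_matrix q J \<longrightarrow>
        f (P * J *\<^sub>v x) = f x)"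

definition nonneg_vecs :: "nat \<Rightarrow> real vec set" where
  "nonneg_vecs q = {x \<in> carrier_vec q. \<forall>i<q. 0 \<le> x $ i}"

definition weakly_majorized :: "nat \<Rightarrow> real vec \<Rightarrow> real vec \<Rightarrow> bool" where
  "weakly_majorized q x y \<longleftrightarrow>
     (\<forall>k \<in> {1..q}. sum_list (take k (descending (list_of_vec x)))
                 \<le> sum_list (take k (descending (list_of_vec y))))"

definition weak_majorization_mono :: "nat \<Rightarrow> (real vec \<Rightarrow> ereal) \<Rightarrow> bool" where
  "weak_majorization_mono q f \<longleftrightarrow>
     (\<forall>x \<in> nonneg_vecs q. \<forall>y \<in> nonneg_vecs q. weakly_majorized q x y \<longrightarrow> f x \<le> f y)"

definition matrix_norm :: "nat \<Rightarrow> nat \<Rightarrow> (real mat \<Rightarrow> real) \<Rightarrow> bool" where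
  "matrix_norm r s N \<longleftrightarrow>
     (\<forall>Z \<in> carrier_mat r s. 0 \<le> N Z \<and> (N Z = 0 \<longleftrightarrow> Z = 0\<^sub>m r s)) \<and>
     (\<forall>Z \<in> carrier_mat r s. \<forall>a. N (a \<cdot>\<^sub>m Z) = \<bar>a\<bar> * N Z) \<and>
     (\<forall>Y \<in> carrier_mat r s. \<forall>Z \<in> carrier_mat r s. N (Y + Z) \<le> N Y + N Z)"

definition unitarily_invariant :: "nat \<Rightarrow> nat \<Rightarrow> (real mat \<Rightarrow> real) \<Rightarrow> bool" where
  "unitarily_invariant r s N \<longleftrightarrow>
     (\<forall>Z \<in> carrier_mat r s. \<forall>U V. orthogonal_matrix r U \<and> orthogonal_matrix s V \<longrightarrow>
        N (U * Z * V\<^sup>T) = N Z)"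

definition optimal_solution :: "'a set \<Rightarrow> ('a \<Rightarrow> ereal) \<Rightarrow> 'a \<Rightarrow> bool" where
  "optimal_solution S h x \<longleftrightarrow> x \<in> S \<and> (\<forall>y \<in> S. h x \<le> h y)"

definition feasible_set :: "nat \<Rightarrow> nat \<Rightarrow> (real mat \<Rightarrow> ereal) \<Rightarrow> real \<Rightarrow> real mat set" where
  "feasible_set m n G c = {X \<in> carrier_mat m n. G X \<le> ereal c}"

text \<open>For \<open>\<mu> = 0\<close> the term \<open>\<mu> F(X)\<close> is \<open>0\<close> also where \<open>F(X) = \<infinity>\<close>.\<close>
definition objective ::
  "real mat \<Rightarrow> real mat \<Rightarrow> real mat \<Rightarrow> (real mat \<Rightarrow> real) \<Rightarrow> (real \<Rightarrow> ereal) \<Rightarrow> real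
     \<Rightarrow> (real mat \<Rightarrow> ereal) \<Rightarrow> real mat \<Rightarrow> ereal" where
  "objective A B C N l \<mu> F X = l (N (A - B * X * C)) + ereal \<mu> * F X"

end

theory Submission
  imports Defs
begin

text \<open>
  The set of optimal solutions is stable under averages \<open>X' = (X + U X V) / 2\<close> in which \<open>U\<close> and \<open>V\<close>
  are orthogonal and the action \<open>X \<mapsto> U X V\<close> is matched by an orthogonal action on the residual,
  that is, \<open>B U = U' B\<close>, \<open>V C = C V'\<close> and \<open>U' A V' = A\<close> for some orthogonal \<open>U'\<close> and \<open>V'\<close>. There are
  two reasons, one for each part of the problem.

  First, \<open>A - B (U X V) C = U' (A - B X C) V'\<close> has the same norm as \<open>A - B X C\<close>, so by convexity the
  norm of the residual does not grow (\<open>optimal_orthogonal_average\<close>). Second, \<open>\<sigma>(X')\<close> is weakly majorized by \<open>\<sigma>(X)\<close>, so \<open>F\<close> and \<open>G\<close>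
  do not grow either. The majorization (\<open>singular_values_orthogonal_average\<close>) follows from Ky
  Fan's principle: the sum of the \<open>k\<close> largest singular values of \<open>X\<close> is the maximum of
  \<open>\<Sum>j<k. p\<^sub>j \<bullet> X q\<^sub>j\<close> over orthonormal \<open>p\<^sub>j\<close> and orthonormal \<open>q\<^sub>j\<close>, an expression that is linear in \<open>X\<close>
  and whose constraint set is invariant under orthogonal maps. Ky Fan's principle (\<open>ky_fan_upper_bound\<close>,
  \<open>ky_fan_attained\<close>) in turn rests on
  the spectral theorem for \<open>X\<^sup>T X\<close>.

  It remains to reach the form \<open>V_B \<Sigma> U_C\<^sup>T\<close> from an arbitrary optimal solution by such averages.
  The reflections \<open>2 V_B V_B\<^sup>T - 1\<close> and \<open>2 U_C U_C\<^sup>T - 1\<close> do not affect the residual, because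
  \<open>B (2 V_B V_B\<^sup>T - 1) = B\<close> and \<open>(2 U_C U_C\<^sup>T - 1) C = C\<close>; averaging with them projects \<open>X\<close> to the form
  \<open>V_B Y U_C\<^sup>T\<close>. Next, for each \<open>k\<close>, the sign of the \<open>k\<close>-th column of \<open>V_B\<close> and of \<open>U_C\<close> is flipped. Since
  \<open>S_B\<close> and \<open>S_C\<close> are diagonal, this corresponds to flipping the \<open>k\<close>-th columns of \<open>U_B\<close> and \<open>V_C\<close> on
  the side of the residual. The conditions \<open>(1 - P_B) A P_C = 0\<close> and
  \<open>P_B A (1 - P_C) = 0\<close> say that \<open>A\<close> respects the splitting of the two spaces by \<open>P_B = U_B U_B\<^sup>T\<close> and
  \<open>P_C = V_C V_C\<^sup>T\<close>, so that a simultaneous flip acts on \<open>A\<close> only through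
  \<open>U_B\<^sup>T A V_C\<close>, which it fixes because that matrix is diagonal
  (\<open>isometric_lift_fixes\<close>). The average annihilates the entries of \<open>Y\<close>
  in row \<open>k\<close> and in column \<open>k\<close> off the diagonal and leaves the other entries alone (\<open>flip_average_index\<close>). After all
  indices have been treated, \<open>Y\<close> is diagonal.
\<close>

section \<open>Matrix products\<close>

lemma index_mult_diagonal_right:
  fixes D :: "real mat"
  assumes D: "D \<in> carrier_mat n n" "diagonal_mat D" and M: "M \<in> carrier_mat k n"
    and "i < k" "j < n"
  shows "(M * D) $$ (i, j) = M $$ (i, j) * D $$ (j, j)"
proof -
  have "(M * D) $$ (i, j) = (\<Sum>l = 0..<n. M $$ (i, l) * D $$ (l, j))"
    using assms by (simp add: scalar_prod_def)
  also have "\<dots> = (\<Sum>l = 0..<n. if l = j then M $$ (i, l) * D $$ (l, j) else 0)"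
    using assms by (intro sum.cong) (auto simp: diagonal_mat_def)
  finally show ?thesis using assms by simp
qed

lemma index_mult_diagonal_left:
  fixes D :: "real mat"
  assumes D: "D \<in> carrier_mat n n" "diagonal_mat D" and M: "M \<in> carrier_mat n k"
    and "i < n" "j < k"
  shows "(D * M) $$ (i, j) = D $$ (i, i) * M $$ (i, j)"
proof -
  have "(D * M) $$ (i, j) = (\<Sum>l = 0..<n. D $$ (i, l) * M $$ (l, j))"
    using assms by (simp add: scalar_prod_def)
  also have "\<dots> = (\<Sum>l = 0..<n. if l = i then D $$ (i, l) * M $$ (l, j) else 0)"
    using assms by (intro sum.cong) (auto simp: diagonal_mat_def)
  finally show ?thesis using assms by simp
qed

lemma diagonal_mat_commute:
  fixes D :: "real mat"
  assumes "D \<in> carrier_mat n n" "diagonal_mat D" "E \<in> carrier_mat n n" "diagonal_mat E"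
  shows "D * E = E * D"
proof (rule eq_matI)
  fix i j assume "i < dim_row (E * D)" "j < dim_col (E * D)"
  then have "i < n" "j < n" using assms by auto
  then show "(D * E) $$ (i, j) = (E * D) $$ (i, j)"
    using index_mult_diagonal_right[OF assms(1,2,3)] index_mult_diagonal_left[OF assms(1,2,3)] assms
    by (cases "i = j") (simp_all del: index_mult_mat(1) add: diagonal_mat_def)
qed (use assms in auto)

text \<open>
  The ring laws below carry equations between dimensions as side conditions. In contrast to
  membership in \<open>carrier_mat\<close> with dimensions that do not occur in the left-hand side, these can be
  discharged by rewriting, which turns the laws into simplification rules.
\<close>
lemma assoc_mult_mat_dim:
  fixes A :: "real mat"
  shows "dim_col A = dim_row B \<Longrightarrow> dim_col B = dim_row C \<Longrightarrow> (A * B) * C = A * (B * C)"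
  by (rule assoc_mult_mat[of A "dim_row A" "dim_row B" B "dim_row C" C "dim_col C"]) auto

lemma left_mult_cancel_dim:
  fixes A :: "real mat"
  shows "A * B = 1\<^sub>m k \<Longrightarrow> dim_col A = dim_row B \<Longrightarrow> dim_col B = dim_row C \<Longrightarrow> dim_row A = k \<Longrightarrow>
    dim_col B = k \<Longrightarrow> A * (B * C) = C"
  by (subst assoc_mult_mat_dim[symmetric]) auto

lemma transpose_mult_dim:
  fixes A :: "real mat"
  shows "dim_col A = dim_row B \<Longrightarrow> (A * B)\<^sup>T = B\<^sup>T * A\<^sup>T"
  by (rule transpose_mult[of A "dim_row A" "dim_row B" B "dim_col B"]) auto

lemma mult_add_distrib_dim:
  fixes A :: "real mat"
  shows "dim_col A = dim_row B \<Longrightarrow> dim_row B = dim_row C \<Longrightarrow> dim_col B = dim_col C \<Longrightarrow>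
      A * (B + C) = A * B + A * C"
    "dim_col A = dim_row B \<Longrightarrow> dim_row B = dim_row C \<Longrightarrow> dim_col B = dim_col C \<Longrightarrow>
      A * (B - C) = A * B - A * C"
    "dim_col B = dim_row A \<Longrightarrow> dim_row B = dim_row C \<Longrightarrow> dim_col B = dim_col C \<Longrightarrow>
      (B + C) * A = B * A + C * A"
    "dim_col B = dim_row A \<Longrightarrow> dim_row B = dim_row C \<Longrightarrow> dim_col B = dim_col C \<Longrightarrow>
      (B - C) * A = B * A - C * A"
  by (auto intro!: mult_add_distrib_mat[of A "dim_row A" "dim_col A" B "dim_col B" C]
      mult_minus_distrib_mat[of A "dim_row A" "dim_col A" B "dim_col B" C]
      add_mult_distrib_mat[of B "dim_row B" "dim_col B" C A "dim_col A"]
      minus_mult_distrib_mat[of B "dim_row B" "dim_col B" C A "dim_col A"])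

lemma mult_smult_dim:
  fixes A :: "real mat"
  shows "dim_col A = dim_row B \<Longrightarrow> A * (c \<cdot>\<^sub>m B) = c \<cdot>\<^sub>m (A * B)"
    "dim_col A = dim_row B \<Longrightarrow> (c \<cdot>\<^sub>m A) * B = c \<cdot>\<^sub>m (A * B)"
  by (auto intro!: mult_smult_distrib[of A "dim_row A" "dim_col A" B "dim_col B"]
      mult_smult_assoc_mat[of A "dim_row A" "dim_col A" B "dim_col B"])

lemma smult_add_dim:
  fixes A :: "real mat"
  shows "dim_row A = dim_row B \<Longrightarrow> dim_col A = dim_col B \<Longrightarrow> c \<cdot>\<^sub>m (A + B) = c \<cdot>\<^sub>m A + c \<cdot>\<^sub>m B"
  by (rule eq_matI) (auto simp: algebra_simps)

lemma mult_mat_unit_vec: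
  fixes A :: "real mat"
  assumes "A \<in> carrier_mat nr nc" "j < nc"
  shows "A *\<^sub>v unit_vec nc j = col A j"
  by (rule eq_vecI) (use assms in auto)

lemmas mat_ring_simps = smult_add_dim assoc_mult_mat_dim mult_add_distrib_dim mult_smult_dim

lemma smult_one_mat_real: "(1 :: real) \<cdot>\<^sub>m X = X"
  by (rule eq_matI) auto

lemma smult_mat_mult_vec:
  fixes A :: "real mat"
  shows "dim_vec v = dim_col A \<Longrightarrow> (c \<cdot>\<^sub>m A) *\<^sub>v v = c \<cdot>\<^sub>v (A *\<^sub>v v)"
  by (rule eq_vecI) (auto simp: scalar_prod_def sum_distrib_left mult.assoc)

section \<open>The spectral theorem for real symmetric matrices\<close>

lemma scalar_prod_self_nonneg: "0 \<le> v \<bullet> (v :: real vec)"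
  unfolding scalar_prod_def by (intro sum_nonneg) auto

lemma scalar_prod_self_eq_0_iff:
  assumes "v \<in> carrier_vec n"
  shows "v \<bullet> (v :: real vec) = 0 \<longleftrightarrow> v = 0\<^sub>v n"
  using assms unfolding scalar_prod_def by (auto simp: sum_nonneg_eq_0_iff intro!: eq_vecI)

lemma symmetric_scalar_prod:
  fixes A :: "real mat"
  assumes "A \<in> carrier_mat n n" "A\<^sup>T = A" "x \<in> carrier_vec n" "y \<in> carrier_vec n"
  shows "(A *\<^sub>v x) \<bullet> y = x \<bullet> (A *\<^sub>v y)"
  using transpose_vec_mult_scalar[of A n n y x] assms by simp

text \<open>
  A complex eigenvector \<open>a + b \<i>\<close> exists by the fundamental theorem of algebra. Comparing \<open>A a \<bullet> b\<close>
  with \<open>a \<bullet> A b\<close> forces the eigenvalue to be real, so that \<open>a\<close> and \<open>b\<close> satisfy the same eigenvalue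
  equation, and one of them is nonzero.
\<close>
lemma symmetric_real_eigenvector:
  fixes A :: "real mat"
  assumes A: "A \<in> carrier_mat n n" and sym: "A\<^sup>T = A" and n: "0 < n"
  obtains v e where "v \<in> carrier_vec n" "v \<bullet> v = 1" "A *\<^sub>v v = e \<cdot>\<^sub>v v"
proof -
  define Ac where "Ac = map_mat complex_of_real A"
  have Ac: "Ac \<in> carrier_mat n n" using A by (simp add: Ac_def)
  from char_poly_factorized[OF Ac] obtain as where
    cp: "char_poly Ac = (\<Prod>a\<leftarrow>as. [:- a, 1:])" and len: "length as = n" by auto
  define z where "z = hd as"
  have "as \<noteq> []" using len n by auto
  then have "poly (char_poly Ac) z = 0"
    unfolding cp z_def by (cases as) auto
  then have "eigenvalue Ac z" by (simp add: eigenvalue_root_char_poly[OF Ac])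
  then obtain w where w: "w \<in> carrier_vec n" "w \<noteq> 0\<^sub>v n" "Ac *\<^sub>v w = z \<cdot>\<^sub>v w"
    using Ac unfolding eigenvalue_def eigenvector_def by auto
  define a where "a = map_vec Re w"
  define b where "b = map_vec Im w"
  have a: "a \<in> carrier_vec n" and b: "b \<in> carrier_vec n" using w by (auto simp: a_def b_def)
  have entry: "(\<Sum>j = 0..<n. complex_of_real (A $$ (i, j)) * w $ j) = z * w $ i" if "i < n" for i
  proof -
    have "(Ac *\<^sub>v w) $ i = (z \<cdot>\<^sub>v w) $ i" using w by simp
    then show ?thesis using that A w(1) by (simp add: Ac_def scalar_prod_def)
  qed
  have Aa: "A *\<^sub>v a = Re z \<cdot>\<^sub>v a - Im z \<cdot>\<^sub>v b"
  proof (rule eq_vecI)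
    fix i assume "i < dim_vec (Re z \<cdot>\<^sub>v a - Im z \<cdot>\<^sub>v b)"
    then have i: "i < n" using b by simp
    show "(A *\<^sub>v a) $ i = (Re z \<cdot>\<^sub>v a - Im z \<cdot>\<^sub>v b) $ i"
      using arg_cong[OF entry[OF i], of Re] i A w(1)
      by (simp add: scalar_prod_def a_def b_def)
  qed (use A b in simp)
  have Ab: "A *\<^sub>v b = Im z \<cdot>\<^sub>v a + Re z \<cdot>\<^sub>v b"
  proof (rule eq_vecI)
    fix i assume "i < dim_vec (Im z \<cdot>\<^sub>v a + Re z \<cdot>\<^sub>v b)"
    then have i: "i < n" using b by simp
    show "(A *\<^sub>v b) $ i = (Im z \<cdot>\<^sub>v a + Re z \<cdot>\<^sub>v b) $ i"
      using arg_cong[OF entry[OF i], of Im] i A w(1)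
      by (simp add: scalar_prod_def a_def b_def)
  qed (use A b in simp)
  have "(A *\<^sub>v a) \<bullet> b = a \<bullet> (A *\<^sub>v b)" by (rule symmetric_scalar_prod[OF A sym a b])
  then have "Im z * (a \<bullet> a + b \<bullet> b) = 0"
    unfolding Aa Ab using a b
    by (simp add: minus_scalar_prod_distrib[of _ n] scalar_prod_add_distrib[of _ n] algebra_simps)
  moreover have "a \<bullet> a \<noteq> 0 \<or> b \<bullet> b \<noteq> 0"
  proof (rule ccontr)
    assume "\<not> ?thesis"
    then have 0: "a = 0\<^sub>v n" "b = 0\<^sub>v n"
      using scalar_prod_self_eq_0_iff[OF a] scalar_prod_self_eq_0_iff[OF b] by auto
    have "w = 0\<^sub>v n"
    proof (rule eq_vecI)
      fix i assume i: "i < dim_vec (0\<^sub>v n :: complex vec)"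
      have "a $ i = 0" "b $ i = 0" using 0 i by auto
      then show "w $ i = 0\<^sub>v n $ i" using i w(1) by (simp add: a_def b_def complex_eq_iff)
    qed (use w in simp)
    with w(2) show False by simp
  qed
  then have pos: "a \<bullet> a + b \<bullet> b \<noteq> 0"
    using scalar_prod_self_nonneg[of a] scalar_prod_self_nonneg[of b] by linarith
  ultimately have "Im z = 0" by simp
  then have "A *\<^sub>v a = Re z \<cdot>\<^sub>v a" "A *\<^sub>v b = Re z \<cdot>\<^sub>v b"
    unfolding Aa Ab using a b by (auto intro!: eq_vecI)
  then obtain x where x: "x \<in> carrier_vec n" "x \<bullet> x \<noteq> 0" "A *\<^sub>v x = Re z \<cdot>\<^sub>v x"
    using \<open>a \<bullet> a \<noteq> 0 \<or> b \<bullet> b \<noteq> 0\<close> a b by blast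
  define c where "c = 1 / sqrt (x \<bullet> x)"
  have "c * (c * (x \<bullet> x)) = 1"
    using x(2) scalar_prod_self_nonneg[of x] by (simp add: c_def)
  moreover have "A *\<^sub>v (c \<cdot>\<^sub>v x) = Re z \<cdot>\<^sub>v (c \<cdot>\<^sub>v x)"
    using x(1,3) by (simp add: mult_mat_vec[OF A] smult_smult_assoc mult.commute)
  ultimately show ?thesis
    using that[of "c \<cdot>\<^sub>v x" "Re z"] x(1) by simp
qed

text \<open>
  The reflection that exchanges \<open>v\<close> with the first unit vector. It replaces the extension of \<open>v\<close>
  to an orthonormal basis in the induction step of the spectral theorem.
\<close>
lemma householder_reflection:
  fixes v :: "real vec"
  assumes v: "v \<in> carrier_vec n" and unit: "v \<bullet> v = 1" and n: "0 < n"
  obtains H where "H \<in> carrier_mat n n" "H\<^sup>T = H" "H * H = 1\<^sub>m n" "col H 0 = v"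
proof -
  \<comment> \<open>The mirror is orthogonal to \<open>v - e\<^sub>0\<close>. If \<open>v = e\<^sub>0\<close> then \<open>t = 0\<close> and \<open>c = 2 / 0 = 0\<close>, so \<open>H\<close> is the identity.\<close>
  define w where "w = (\<lambda>i. v $ i - (if i = 0 then 1 else 0))"
  define t where "t = (\<Sum>i = 0..<n. w i * w i)"
  define c where "c = 2 / t"
  define H where "H = mat n n (\<lambda>(i, j). (if i = j then 1 else 0) - c * w i * w j)"
  have unit': "(\<Sum>i = 0..<n. v $ i * v $ i) = 1" using unit v by (simp add: scalar_prod_def)
  have "t = (\<Sum>i = 0..<n. v $ i * v $ i + (if i = 0 then 1 - 2 * v $ 0 else 0))"
    unfolding t_def w_def by (intro sum.cong) (auto simp: algebra_simps)
  also have "\<dots> = 1 + (1 - 2 * v $ 0)"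
    using n unit' by (simp add: sum.distrib)
  finally have t: "t = 2 - 2 * v $ 0" by simp
  have H: "H \<in> carrier_mat n n" by (simp add: H_def)
  have cct: "c * c * t = 2 * c" by (simp add: c_def)
  have "H * H = 1\<^sub>m n"
  proof (rule eq_matI)
    fix i j assume "i < dim_row (1\<^sub>m n :: real mat)" "j < dim_col (1\<^sub>m n :: real mat)"
    then have ij: "i < n" "j < n" by auto
    have "(H * H) $$ (i, j) = (\<Sum>k = 0..<n. H $$ (i, k) * H $$ (k, j))"
      using ij H by (simp add: scalar_prod_def)
    also have "\<dots> = (\<Sum>k = 0..<n. (if k = i then (if i = j then 1 else 0) - c * w i * w j else 0)
        - (if k = j then c * w i * w j else 0) + c * c * w i * w j * (w k * w k))"
      using ij by (intro sum.cong) (auto simp: H_def algebra_simps)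
    also have "\<dots> = (if i = j then 1 else 0) - 2 * (c * w i * w j) + c * c * w i * w j * t"
      using ij by (simp add: sum.distrib sum_subtractf sum_distrib_left[symmetric] t_def)
    also have "\<dots> = (if i = j then 1 else 0) + w i * w j * (c * c * t - 2 * c)"
      by (simp add: algebra_simps)
    finally show "(H * H) $$ (i, j) = 1\<^sub>m n $$ (i, j)" using cct ij by simp
  qed (use H in auto)
  moreover have "col H 0 = v"
  proof (rule eq_vecI)
    fix i assume "i < dim_vec v"
    then have i: "i < n" using v by simp
    have "c * w 0 * w i = - w i"
    proof (cases "t = 0")
      case True
      then have "\<forall>i\<in>{0..<n}. w i * w i = 0"
        unfolding t_def by (subst (asm) sum_nonneg_eq_0_iff) auto
      then show ?thesis using i by simp
    next
      case False
      moreover have "w 0 = - t / 2" using t by (simp add: w_def)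
      ultimately show ?thesis by (simp add: c_def)
    qed
    then show "col H 0 $ i = v $ i" using i n by (simp add: H_def w_def mult_ac)
  qed (use v H in simp)
  moreover have "H\<^sup>T = H" by (rule eq_matI) (auto simp: H_def)
  ultimately show ?thesis using H that by blast
qed

text \<open>
  Induction on the dimension: conjugation with a Householder reflection moves an eigenvector to the
  first unit vector. Symmetry then makes the matrix block diagonal, with a \<open>1 \<times> 1\<close> block and a smaller
  symmetric block.
\<close>
theorem symmetric_real_spectral:
  fixes A :: "real mat"
  assumes "A \<in> carrier_mat n n" "A\<^sup>T = A"
  shows "\<exists>U D. U \<in> carrier_mat n n \<and> U\<^sup>T * U = 1\<^sub>m n \<and> D \<in> carrier_mat n n \<and> diagonal_mat D
    \<and> A = U * D * U\<^sup>T"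
  using assms
proof (induction n arbitrary: A)
  case 0
  then show ?case
    by (intro exI[of _ "1\<^sub>m 0"]) (auto simp: diagonal_mat_def)
next
  case (Suc n)
  note A = Suc.prems(1) and sym = Suc.prems(2)
  obtain v e where v: "v \<in> carrier_vec (Suc n)" "v \<bullet> v = 1" "A *\<^sub>v v = e \<cdot>\<^sub>v v"
    using symmetric_real_eigenvector[OF A sym] by auto
  obtain H where H: "H \<in> carrier_mat (Suc n) (Suc n)" "H\<^sup>T = H" "H * H = 1\<^sub>m (Suc n)" "col H 0 = v"
    using householder_reflection[OF v(1,2)] by auto
  have dims [simp]: "dim_row H = Suc n" "dim_col H = Suc n" "dim_row A = Suc n" "dim_col A = Suc n"
    using H A by auto
  define M where "M = H * A * H"
  have M: "M \<in> carrier_mat (Suc n) (Suc n)" by (auto simp: M_def intro!: carrier_matI)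
  have Msym: "M\<^sup>T = M" by (simp add: M_def transpose_mult_dim H sym assoc_mult_mat_dim)
  have AHMH: "A = H * M * H"
    by (simp add: M_def assoc_mult_mat_dim H left_mult_cancel_dim[OF H(3)])
  have Hv: "H *\<^sub>v v = unit_vec (Suc n) 0"
  proof -
    have "H *\<^sub>v v = col (H * H) 0" using H(4) by (subst col_mult2[OF H(1) H(1)]) auto
    then show ?thesis using H(3) by simp
  qed
  have "col M 0 = H *\<^sub>v (A *\<^sub>v v)"
    unfolding M_def assoc_mult_mat[OF H(1) A H(1)] H(4)[symmetric]
    using H(1) A by (simp add: col_mult2[of _ "Suc n" "Suc n" _ "Suc n"] del: assoc_mult_mat col_mult)
  then have col: "col M 0 = e \<cdot>\<^sub>v unit_vec (Suc n) 0"
    using v Hv H(1) by (simp add: mult_mat_vec[OF H(1)])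
  have M_i0: "M $$ (i, 0) = (if i = 0 then e else 0)" if "i < Suc n" for i
    using arg_cong[OF col, of "\<lambda>x. x $ i"] that M by simp
  have M_0i: "M $$ (0, i) = (if i = 0 then e else 0)" if "i < Suc n" for i
    using M_i0[OF that] arg_cong[OF Msym, of "\<lambda>X. X $$ (i, 0)"] that M by simp
  define A' where "A' = mat n n (\<lambda>(i, j). M $$ (Suc i, Suc j))"
  have A': "A' \<in> carrier_mat n n" by (simp add: A'_def)
  have "A'\<^sup>T = A'"
  proof (rule eq_matI)
    fix i j assume "i < dim_row A'" "j < dim_col A'"
    then show "A'\<^sup>T $$ (i, j) = A' $$ (i, j)"
      using arg_cong[OF Msym, of "\<lambda>X. X $$ (Suc i, Suc j)"] M by (simp add: A'_def)
  qed (auto simp: A'_def)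
  from Suc.IH[OF A' this] obtain U D where U: "U \<in> carrier_mat n n" "U\<^sup>T * U = 1\<^sub>m n"
    and D: "D \<in> carrier_mat n n" "diagonal_mat D" and A'UDU: "A' = U * D * U\<^sup>T" by auto
  define E where "E = e \<cdot>\<^sub>m 1\<^sub>m 1"
  have E: "E \<in> carrier_mat 1 1" by (simp add: E_def)
  let ?fb = "\<lambda>X Y. four_block_mat X (0\<^sub>m 1 n) (0\<^sub>m n 1) Y"
  have M_blocks: "M = ?fb E A'"
    by (rule eq_matI) (use M M_i0 M_0i in \<open>auto simp: E_def A'_def\<close>)
  have fb_mult: "?fb X Y * ?fb X' Y' = ?fb (X * X') (Y * Y')"
    if "X \<in> carrier_mat 1 1" "X' \<in> carrier_mat 1 1" "Y \<in> carrier_mat n n" "Y' \<in> carrier_mat n n"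
    for X X' Y Y' :: "real mat"
    using that by (subst mult_four_block_mat) auto
  have fb_carrier: "?fb X Y \<in> carrier_mat (Suc n) (Suc n)"
    if "X \<in> carrier_mat 1 1" "Y \<in> carrier_mat n n" for X Y :: "real mat"
    using that four_block_carrier_mat[of X 1 1 Y n n] by simp
  define W where "W = ?fb (1\<^sub>m 1) U"
  have W: "W \<in> carrier_mat (Suc n) (Suc n)" unfolding W_def by (rule fb_carrier) (use U in auto)
  have WT: "W\<^sup>T = ?fb (1\<^sub>m 1) (U\<^sup>T)" unfolding W_def
    by (subst transpose_four_block_mat) (use U in auto)
  have WTW: "W\<^sup>T * W = 1\<^sub>m (Suc n)"
    unfolding WT unfolding W_def using U by (subst fb_mult) auto
  have M_W: "M = W * ?fb E D * W\<^sup>T"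
  proof -
    have "W * ?fb E D = ?fb E (U * D)"
      unfolding W_def by (subst fb_mult) (use U D E in auto)
    moreover have "?fb E (U * D) * W\<^sup>T = ?fb E (U * D * U\<^sup>T)"
      unfolding WT by (subst fb_mult) (use U D E in auto)
    ultimately show ?thesis by (simp only: M_blocks A'UDU)
  qed
  have fbD: "?fb E D \<in> carrier_mat (Suc n) (Suc n)" by (rule fb_carrier[OF E D(1)])
  have diag: "diagonal_mat (?fb E D)"
    using D E unfolding diagonal_mat_def by auto
  have dW [simp]: "dim_row W = Suc n" "dim_col W = Suc n" using W by auto
  define DB where "DB = ?fb E D"
  have [simp]: "dim_row DB = Suc n" "dim_col DB = Suc n" using fbD by (auto simp: DB_def)
  have "(H * W)\<^sup>T * (H * W) = 1\<^sub>m (Suc n)"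
    by (simp add: transpose_mult_dim H assoc_mult_mat_dim left_mult_cancel_dim[OF H(3)] WTW)
  moreover have "A = (H * W) * DB * (H * W)\<^sup>T"
    by (subst AHMH, subst M_W[folded DB_def]) (simp add: transpose_mult_dim H assoc_mult_mat_dim)
  moreover have "H * W \<in> carrier_mat (Suc n) (Suc n)" using H W by simp
  ultimately show ?case using fbD[folded DB_def] diag[folded DB_def] by blast
qed

section \<open>Singular values and singular vectors\<close>

text \<open>
  Pairwise orthogonal vectors, each of norm one or zero. Zero vectors are admitted because the left singular
  vectors that belong to the singular value zero are not determined by \<open>X\<close>; setting them to
  zero avoids completing an orthonormal system, and Bessel's inequality still holds.
\<close>
definition unit_or_zero_family :: "nat \<Rightarrow> nat \<Rightarrow> (nat \<Rightarrow> real vec) \<Rightarrow> bool" where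
  "unit_or_zero_family k d p \<longleftrightarrow>
     (\<forall>i<k. p i \<in> carrier_vec d \<and> p i \<bullet> p i \<in> {0, 1}) \<and> (\<forall>i<k. \<forall>j<k. i \<noteq> j \<longrightarrow> p i \<bullet> p j = 0)"

lemma unit_or_zero_family_antimono:
  "unit_or_zero_family n d p \<Longrightarrow> k \<le> n \<Longrightarrow> unit_or_zero_family k d p"
  unfolding unit_or_zero_family_def by auto

text \<open>
  Induction on the number of vectors: subtracting the component along the last vector changes none
  of the other coefficients and lowers the squared norm by at least the square of the last one.
\<close>
lemma bessel_inequality:
  assumes "unit_or_zero_family k d p" "x \<in> carrier_vec d"
  shows "(\<Sum>i<k. (p i \<bullet> x)\<^sup>2) \<le> x \<bullet> x"
  using assms
proof (induction k arbitrary: x)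
  case 0
  then show ?case by (simp add: scalar_prod_self_nonneg)
next
  case (Suc k)
  have p: "p i \<in> carrier_vec d" if "i \<le> k" for i
    using Suc.prems(1) that by (auto simp: unit_or_zero_family_def)
  have orth: "p i \<bullet> p k = 0" if "i < k" for i
    using Suc.prems(1) that by (auto simp: unit_or_zero_family_def)
  have pk: "p k \<in> carrier_vec d" "p k \<bullet> p k \<in> {0, 1}" and x: "x \<in> carrier_vec d"
    using Suc.prems by (auto simp: unit_or_zero_family_def)
  define c where "c = p k \<bullet> x"
  define y where "y = x - c \<cdot>\<^sub>v p k"
  have y: "y \<in> carrier_vec d" using x pk by (simp add: y_def)
  have "p i \<bullet> y = p i \<bullet> x" if "i < k" for i
    unfolding y_def using orth[OF that] p[of i] that x pk
    by (simp add: scalar_prod_minus_distrib[of _ d])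
  then have "(\<Sum>i<k. (p i \<bullet> x)\<^sup>2) = (\<Sum>i<k. (p i \<bullet> y)\<^sup>2)" by simp
  also have "\<dots> \<le> y \<bullet> y"
    by (rule Suc.IH[OF unit_or_zero_family_antimono[OF Suc.prems(1)] y]) simp
  also have "y \<bullet> y = x \<bullet> x - 2 * c * c + c * c * (p k \<bullet> p k)"
    unfolding y_def using x pk(1)
    by (simp add: scalar_prod_minus_distrib[of _ d] minus_scalar_prod_distrib[of _ d]
        comm_scalar_prod[of x d "p k"] c_def algebra_simps)
  also have "\<dots> \<le> x \<bullet> x - c\<^sup>2"
    using pk(2) by (auto simp: power2_eq_square)
  finally show ?case by (simp add: c_def)
qed

lemma unit_or_zero_family_isometry:
  assumes "unit_or_zero_family k d p" "U \<in> carrier_mat d d" "U\<^sup>T * U = 1\<^sub>m d"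
  shows "unit_or_zero_family k d (\<lambda>i. U *\<^sub>v p i)"
proof -
  have "(U *\<^sub>v x) \<bullet> (U *\<^sub>v y) = x \<bullet> y" if x: "x \<in> carrier_vec d" and y: "y \<in> carrier_vec d" for x y
  proof -
    have "(U *\<^sub>v x) \<bullet> (U *\<^sub>v y) = (U\<^sup>T *\<^sub>v (U *\<^sub>v x)) \<bullet> y"
      using assms(2) x y by (subst transpose_vec_mult_scalar[of U d d]) auto
    also have "U\<^sup>T *\<^sub>v (U *\<^sub>v x) = x"
      using assms(2,3) x by (subst assoc_mult_mat_vec[symmetric, of _ d d _ d]) auto
    finally show ?thesis .
  qed
  then show ?thesis using assms(1,2) unfolding unit_or_zero_family_def by auto
qed

lemma proots_prod_list_linear_factors:
  "proots (\<Prod>a\<leftarrow>as. [:- a, 1:]) = mset (as :: real list)"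
proof (induction as)
  case (Cons a as)
  have "(\<Prod>a\<leftarrow>as. [:- a, 1:]) \<noteq> (0 :: real poly)"
    by (auto simp: prod_list_zero_iff)
  then show ?case using Cons by (simp add: proots_mult del: mult_pCons_left)
qed auto

text \<open>
  An orthonormal eigenbasis \<open>v\<close> of \<open>X\<^sup>T X\<close>, ordered by decreasing eigenvalue, consists of right
  singular vectors; the vectors \<open>X v\<^sub>i\<close> are pairwise orthogonal with norms \<open>\<tau>\<^sub>i\<close>. The characteristic polynomial of
  \<open>X\<^sup>T X\<close> splits over the reals with the same eigenvalues as roots, which identifies \<open>\<tau>\<close> with
  the list of singular values. Completeness of \<open>v\<close> is stated as Parseval's identity.
\<close>
theorem singular_system:
  assumes X: "X \<in> carrier_mat m n"
  obtains \<tau> u v where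
    "\<And>i. i < n \<Longrightarrow> 0 \<le> \<tau> i" "\<And>i j. i \<le> j \<Longrightarrow> j < n \<Longrightarrow> \<tau> j \<le> \<tau> i"
    "unit_or_zero_family n n v" "unit_or_zero_family n m u"
    "\<And>i. i < n \<Longrightarrow> X *\<^sub>v v i = \<tau> i \<cdot>\<^sub>v u i" "\<And>i. i < n \<Longrightarrow> \<tau> i * (u i \<bullet> u i) = \<tau> i"
    "\<And>x y. x \<in> carrier_vec n \<Longrightarrow> y \<in> carrier_vec n \<Longrightarrow> x \<bullet> y = (\<Sum>i<n. (v i \<bullet> x) * (v i \<bullet> y))"
    "list_of_vec (singular_values X) = map \<tau> [0..<min m n]"
proof -
  let ?S = "X\<^sup>T * X"
  have S: "?S \<in> carrier_mat n n" and Ssym: "?S\<^sup>T = ?S"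
    using X by (auto simp: transpose_mult_dim)
  obtain U D where U: "U \<in> carrier_mat n n" "U\<^sup>T * U = 1\<^sub>m n" and D: "D \<in> carrier_mat n n" "diagonal_mat D"
    and SUDU: "?S = U * D * U\<^sup>T" using symmetric_real_spectral[OF S Ssym] by auto
  have UUT: "U * U\<^sup>T = 1\<^sub>m n" using mat_mult_left_right_inverse[OF _ U(1) U(2)] U(1) by simp
  define ds where "ds = diag_mat D"
  have len: "length ds = n" using D by (simp add: ds_def diag_mat_def)
  have "upper_triangular D" using D by (auto simp: diagonal_mat_def upper_triangular_def)
  moreover have "similar_mat ?S D"
    by (rule similar_matI[of _ _ U "U\<^sup>T" n]) (use S D U UUT SUDU in auto)
  ultimately have "char_poly ?S = (\<Prod>a\<leftarrow>ds. [:- a, 1:])"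
    using char_poly_similar char_poly_upper_triangular[OF D(1)] by (metis ds_def)
  then have proots: "proots (char_poly ?S) = mset ds"
    by (simp add: proots_prod_list_linear_factors)
  define L where "L = rev (sort (map sqrt ds))"
  have sv: "list_of_vec (singular_values X) = take (min m n) L"
    using X unfolding singular_values_def proots L_def
    by (simp flip: mset_map add: list_vec)
  have lenL: "length L = n" by (simp add: L_def len)
  have "mset L = mset (map sqrt ds)" by (simp add: L_def)
  then obtain p where p: "p permutes {..<length (map sqrt ds)}" "permute_list p (map sqrt ds) = L"
    by (rule mset_eq_permutation)
  then have p: "p permutes {..<n}" "permute_list p (map sqrt ds) = L" using len by auto
  have pn: "p i < n" if "i < n" for i using permutes_in_image[OF p(1)] that by simp
  define \<tau> where "\<tau> = (\<lambda>i. L ! i)"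
  define v where "v = (\<lambda>i. col U (p i))"
  define d where "d = (\<lambda>i. D $$ (p i, p i))"
  have v: "v i \<in> carrier_vec n" for i using U by (auto simp: v_def)
  have \<tau>d: "\<tau> i = sqrt (d i)" if "i < n" for i
  proof -
    have "L ! i = map sqrt ds ! p i"
      using p that len by (metis length_map lessThan_iff permute_list_nth)
    then show ?thesis using pn[OF that] len D by (simp add: \<tau>_def d_def ds_def diag_mat_def)
  qed
  have vv: "v i \<bullet> v j = (if i = j then 1 else 0)" if "i < n" "j < n" for i j
  proof -
    have "v i \<bullet> v j = (U\<^sup>T * U) $$ (p i, p j)"
      using U(1) pn that by (simp add: v_def)
    then show ?thesis using U(2) pn that permutes_inj[OF p(1)] by (auto simp: inj_eq)
  qed
  have Sv: "?S *\<^sub>v v i = d i \<cdot>\<^sub>v v i" if "i < n" for i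
  proof -
    have "?S * U = U * D" unfolding SUDU using U D
      by (simp add: assoc_mult_mat_dim)
    moreover have "?S *\<^sub>v v i = col (?S * U) (p i)"
      using U(1) S pn[OF that] by (subst col_mult2[OF S U(1)]) (auto simp: v_def)
    moreover have "col (U * D) (p i) = d i \<cdot>\<^sub>v v i"
    proof (rule eq_vecI)
      fix l assume "l < dim_vec (d i \<cdot>\<^sub>v v i)"
      then have l: "l < n" using U by (simp add: v_def)
      have "col (U * D) (p i) $ l = (U * D) $$ (l, p i)"
        using l pn[OF that] U(1) D(1) by (intro index_col) auto
      then show "col (U * D) (p i) $ l = (d i \<cdot>\<^sub>v v i) $ l"
        unfolding index_mult_diagonal_right[OF D U(1) l pn[OF that]]
        using l pn[OF that] U(1) by (simp add: v_def d_def)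
    qed (use U D in \<open>simp add: v_def\<close>)
    ultimately show ?thesis by simp
  qed
  have XvXv: "(X *\<^sub>v v i) \<bullet> (X *\<^sub>v v j) = (if i = j then d i else 0)" if "i < n" "j < n" for i j
  proof -
    have "(X *\<^sub>v v i) \<bullet> (X *\<^sub>v v j) = (X\<^sup>T *\<^sub>v (X *\<^sub>v v i)) \<bullet> v j"
      using X v by (subst transpose_vec_mult_scalar[OF X]) auto
    also have "X\<^sup>T *\<^sub>v (X *\<^sub>v v i) = ?S *\<^sub>v v i"
      using X v by (subst assoc_mult_mat_vec[of _ n m _ n]) auto
    also have "\<dots> = d i \<cdot>\<^sub>v v i" by (rule Sv[OF that(1)])
    finally show ?thesis using vv[OF that] v[of i] v[of j] by simp
  qed
  have d0: "0 \<le> d i" if "i < n" for i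
    using XvXv[OF that that] scalar_prod_self_nonneg[of "X *\<^sub>v v i"] by simp
  have \<tau>\<tau>: "\<tau> i * \<tau> i = d i" if "i < n" for i using \<tau>d[OF that] d0[OF that] by simp
  \<comment> \<open>For \<open>\<tau> i = 0\<close> the vector \<open>X *\<^sub>v v i\<close> vanishes and cannot be normalized.\<close>
  define u where "u = (\<lambda>i. if \<tau> i = 0 then 0\<^sub>v m else (1 / \<tau> i) \<cdot>\<^sub>v (X *\<^sub>v v i))"
  have u: "u i \<in> carrier_vec m" for i using X v by (auto simp: u_def)
  have uu: "u i \<bullet> u j = (if i = j \<and> \<tau> i \<noteq> 0 then 1 else 0)" if "i < n" "j < n" for i j
    using XvXv[OF that] \<tau>\<tau>[OF that(1)] X v that by (auto simp: u_def)
  show thesis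
  proof (rule that)
    show "0 \<le> \<tau> i" if "i < n" for i using \<tau>d[OF that] d0[OF that] by simp
    have "sorted_wrt (\<ge>) L" by (simp add: L_def sorted_wrt_rev)
    then show "\<tau> j \<le> \<tau> i" if "i \<le> j" "j < n" for i j
      using that lenL unfolding \<tau>_def by (cases "i = j") (auto simp: sorted_wrt_iff_nth_less)
    show "unit_or_zero_family n n v" using v vv by (simp add: unit_or_zero_family_def)
    show "unit_or_zero_family n m u" using u uu by (simp add: unit_or_zero_family_def)
    show "X *\<^sub>v v i = \<tau> i \<cdot>\<^sub>v u i" if "i < n" for i
    proof (cases "\<tau> i = 0")
      case True
      then have "(X *\<^sub>v v i) \<bullet> (X *\<^sub>v v i) = 0" using XvXv[OF that that] \<tau>\<tau>[OF that] by simp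
      then have "X *\<^sub>v v i = 0\<^sub>v m" using X v scalar_prod_self_eq_0_iff[of "X *\<^sub>v v i" m] by simp
      then show ?thesis using True by (auto simp: u_def)
    next
      case False
      then show ?thesis by (simp add: u_def smult_smult_assoc)
    qed
    show "\<tau> i * (u i \<bullet> u i) = \<tau> i" if "i < n" for i using uu[OF that that] by simp
    show "x \<bullet> y = (\<Sum>i<n. (v i \<bullet> x) * (v i \<bullet> y))"
      if xy: "x \<in> carrier_vec n" "y \<in> carrier_vec n" for x y
    proof -
      have "x \<bullet> y = x \<bullet> (U *\<^sub>v (U\<^sup>T *\<^sub>v y))"
        using xy U UUT by (subst assoc_mult_mat_vec[symmetric, of _ n n _ n]) auto
      also have "\<dots> = (U\<^sup>T *\<^sub>v x) \<bullet> (U\<^sup>T *\<^sub>v y)"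
        using xy U by (subst transpose_vec_mult_scalar[of U n n]) auto
      also have "\<dots> = (\<Sum>i<n. (col U i \<bullet> x) * (col U i \<bullet> y))"
        using U by (simp add: scalar_prod_def[of "U\<^sup>T *\<^sub>v x"] atLeast0LessThan)
      also have "\<dots> = (\<Sum>i<n. (v i \<bullet> x) * (v i \<bullet> y))"
        unfolding v_def by (rule sum.permute[OF p(1), unfolded comp_def])
      finally show ?thesis .
    qed
    show "list_of_vec (singular_values X) = map \<tau> [0..<min m n]"
      unfolding sv \<tau>_def by (rule nth_equalityI) (auto simp: lenL)
  qed
qed

lemma dim_singular_values:
  assumes "X \<in> carrier_mat m n"
  shows "dim_vec (singular_values X) = min m n"
proof (rule singular_system[OF assms])
  fix \<tau> assume "list_of_vec (singular_values X) = map \<tau> [0..<min m n]"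
  then have "length (list_of_vec (singular_values X)) = min m n" by simp
  then show ?thesis by simp
qed

lemma singular_values_nonneg:
  assumes "X \<in> carrier_mat m n"
  shows "singular_values X \<in> nonneg_vecs (min m n)"
proof (rule singular_system[OF assms])
  fix \<tau> assume \<tau>: "\<And>i. i < n \<Longrightarrow> (0 :: real) \<le> \<tau> i"
    "list_of_vec (singular_values X) = map \<tau> [0..<min m n]"
  have "singular_values X $ i = \<tau> i" if "i < min m n" for i
    using arg_cong[OF \<tau>(2), of "\<lambda>xs. xs ! i"] that dim_singular_values[OF assms]
    by (simp add: list_of_vec_index)
  then show ?thesis
    using \<tau>(1) dim_singular_values[OF assms] by (auto simp: nonneg_vecs_def intro: carrier_vecI)
qed

lemma descending_singular_values:
  assumes "X \<in> carrier_mat m n"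
  shows "descending (list_of_vec (singular_values X)) = list_of_vec (singular_values X)"
proof (rule singular_system[OF assms])
  fix \<tau> assume \<tau>: "\<And>i j. i \<le> j \<Longrightarrow> j < n \<Longrightarrow> (\<tau> j :: real) \<le> \<tau> i"
    "list_of_vec (singular_values X) = map \<tau> [0..<min m n]"
  have "sorted (rev (map \<tau> [0..<min m n]))"
    unfolding sorted_wrt_rev using \<tau>(1) by (auto simp: sorted_wrt_iff_nth_less)
  then have "sort (map \<tau> [0..<min m n]) = rev (map \<tau> [0..<min m n])"
    by (intro properties_for_sort) auto
  then show ?thesis unfolding descending_def \<tau>(2) by simp
qed

section \<open>Ky Fan's variational principle and majorization\<close>

text \<open>
  With a total weight of at most \<open>k\<close> and at most one unit on each term, the best choice is to put
  full weight on the \<open>k\<close> largest terms. The proof compares every term with the threshold value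
  \<open>\<tau> (k - 1)\<close>.
\<close>
lemma weighted_sum_le_top_sum:
  fixes \<tau> w :: "nat \<Rightarrow> real"
  assumes nonneg: "\<And>i. i < n \<Longrightarrow> 0 \<le> \<tau> i" and desc: "\<And>i j. i \<le> j \<Longrightarrow> j < n \<Longrightarrow> \<tau> j \<le> \<tau> i"
    and w: "\<And>i. i < n \<Longrightarrow> 0 \<le> w i" "\<And>i. i < n \<Longrightarrow> w i \<le> 1" and sum_w: "(\<Sum>i<n. w i) \<le> real k"
    and k: "k \<le> n"
  shows "(\<Sum>i<n. \<tau> i * w i) \<le> (\<Sum>i<k. \<tau> i)"
proof (cases k)
  case 0
  moreover have "0 \<le> (\<Sum>i<n. w i)" using w(1) by (intro sum_nonneg) auto
  ultimately have "(\<Sum>i<n. w i) = 0" using sum_w by simp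
  then have "w i = 0" if "i < n" for i
    using w that by (subst (asm) sum_nonneg_eq_0_iff) auto
  then show ?thesis using 0 by simp
next
  case (Suc k')
  define t where "t = \<tau> k'"
  have t: "0 \<le> t" using nonneg Suc k by (simp add: t_def)
  let ?ind = "\<lambda>i. if i < k then 1 else (0 :: real)"
  have ind: "(\<Sum>i<n. f i * ?ind i) = (\<Sum>i<k. f i)" for f
  proof -
    have "(\<Sum>i<n. f i * ?ind i) = (\<Sum>i<n. if i \<in> {..<k} then f i else 0)" by (intro sum.cong) auto
    also have "\<dots> = (\<Sum>i\<in>{..<n} \<inter> {..<k}. f i)" by (simp add: sum.inter_restrict)
    also have "{..<n} \<inter> {..<k} = {..<k}" using k by auto
    finally show ?thesis .
  qed
  have "(\<Sum>i<n. \<tau> i * w i) - (\<Sum>i<k. \<tau> i) = (\<Sum>i<n. \<tau> i * (w i - ?ind i))"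
    unfolding ind[symmetric] by (simp only: sum_subtractf[symmetric] right_diff_distrib)
  also have "\<dots> \<le> (\<Sum>i<n. t * (w i - ?ind i))"
  proof (rule sum_mono)
    fix i assume i: "i \<in> {..<n}"
    show "\<tau> i * (w i - ?ind i) \<le> t * (w i - ?ind i)"
    proof (cases "i < k")
      case True
      then have "t \<le> \<tau> i" unfolding t_def using desc[of i k'] Suc k by simp
      then show ?thesis using True w(2)[of i] i by (simp add: mult_right_mono_neg)
    next
      case False
      then have "\<tau> i \<le> t" unfolding t_def using desc[of k' i] Suc i by simp
      then show ?thesis using False w(1)[of i] i by (simp add: mult_right_mono)
    qed
  qed
  also have "\<dots> = t * ((\<Sum>i<n. w i) - real k)"
    using ind[of "\<lambda>_. 1"] by (simp add: sum_distrib_left[symmetric] sum_subtractf)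
  also have "\<dots> \<le> 0" using t sum_w by (simp add: mult_nonneg_nonpos)
  finally show ?thesis by simp
qed

text \<open>
  In terms of the singular vectors the left-hand side is \<open>\<Sum>i. \<tau>\<^sub>i (\<Sum>j. (p\<^sub>j \<bullet> u\<^sub>i) (q\<^sub>j \<bullet> v\<^sub>i))\<close>. The inequality
  between the geometric and the arithmetic mean bounds the coefficient of \<open>\<tau>\<^sub>i\<close> by a weight, and Bessel's
  inequality, applied to each of the four families, shows that every weight is at most one and
  that their total is at most \<open>k\<close>.
\<close>
lemma ky_fan_upper_bound:
  assumes X: "X \<in> carrier_mat m n" and k: "k \<le> min m n"
    and p: "unit_or_zero_family k m p" and q: "unit_or_zero_family k n q"
  shows "(\<Sum>j<k. p j \<bullet> (X *\<^sub>v q j)) \<le> sum_list (take k (list_of_vec (singular_values X)))"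
proof (rule singular_system[OF X])
  fix \<tau> u v
  assume \<tau>: "\<And>i. i < n \<Longrightarrow> 0 \<le> \<tau> i" "\<And>i j. i \<le> j \<Longrightarrow> j < n \<Longrightarrow> \<tau> j \<le> \<tau> i"
    and v: "unit_or_zero_family n n v" and u: "unit_or_zero_family n m u"
    and Xv: "\<And>i. i < n \<Longrightarrow> X *\<^sub>v v i = \<tau> i \<cdot>\<^sub>v u i"
    and parseval: "\<And>x y. x \<in> carrier_vec n \<Longrightarrow> y \<in> carrier_vec n \<Longrightarrow>
      x \<bullet> y = (\<Sum>i<n. (v i \<bullet> x) * (v i \<bullet> y))"
    and sv: "list_of_vec (singular_values X) = map \<tau> [0..<min m n]"
  have pc: "p j \<in> carrier_vec m" "p j \<bullet> p j \<le> 1" and qc: "q j \<in> carrier_vec n" "q j \<bullet> q j \<le> 1"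
    if "j < k" for j
    using p q that by (auto simp: unit_or_zero_family_def)
  have uc: "u i \<in> carrier_vec m" "u i \<bullet> u i \<le> 1" and vc: "v i \<in> carrier_vec n" "v i \<bullet> v i \<le> 1"
    if "i < n" for i
    using u v that by (auto simp: unit_or_zero_family_def)
  have expand: "p j \<bullet> (X *\<^sub>v q j) = (\<Sum>i<n. \<tau> i * ((p j \<bullet> u i) * (q j \<bullet> v i)))" if j: "j < k" for j
  proof -
    have "p j \<bullet> (X *\<^sub>v q j) = (X\<^sup>T *\<^sub>v p j) \<bullet> q j"
      using transpose_vec_mult_scalar[OF X qc(1)[OF j] pc(1)[OF j]] by simp
    also have "\<dots> = (\<Sum>i<n. (v i \<bullet> (X\<^sup>T *\<^sub>v p j)) * (v i \<bullet> q j))"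
      using X pc[OF j] qc[OF j] by (intro parseval) auto
    also have "\<dots> = (\<Sum>i<n. \<tau> i * ((p j \<bullet> u i) * (q j \<bullet> v i)))"
    proof (rule sum.cong)
      fix i assume "i \<in> {..<n}"
      then have i: "i < n" by simp
      have "v i \<bullet> (X\<^sup>T *\<^sub>v p j) = (X\<^sup>T *\<^sub>v p j) \<bullet> v i"
        using X vc[OF i] pc[OF j] by (intro comm_scalar_prod[of _ n]) auto
      also have "\<dots> = p j \<bullet> (\<tau> i \<cdot>\<^sub>v u i)"
        using transpose_vec_mult_scalar[OF X vc(1)[OF i] pc(1)[OF j]] Xv[OF i] by simp
      also have "\<dots> = \<tau> i * (p j \<bullet> u i)" using pc[OF j] uc[OF i] by simp
      finally show "(v i \<bullet> (X\<^sup>T *\<^sub>v p j)) * (v i \<bullet> q j) = \<tau> i * ((p j \<bullet> u i) * (q j \<bullet> v i))"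
        using comm_scalar_prod[OF vc(1)[OF i] qc(1)[OF j]] by simp
    qed simp
    finally show ?thesis .
  qed
  define w where "w = (\<lambda>i. \<Sum>j<k. ((p j \<bullet> u i)\<^sup>2 + (q j \<bullet> v i)\<^sup>2) / 2)"
  have w0: "0 \<le> w i" for i unfolding w_def by (intro sum_nonneg) auto
  have w1: "w i \<le> 1" if i: "i < n" for i
    using bessel_inequality[OF p uc(1)[OF i]] bessel_inequality[OF q vc(1)[OF i]] uc(2)[OF i] vc(2)[OF i]
    by (simp add: w_def sum.distrib sum_divide_distrib[symmetric])
  have "(\<Sum>i<n. w i) = (\<Sum>j<k. \<Sum>i<n. ((p j \<bullet> u i)\<^sup>2 + (q j \<bullet> v i)\<^sup>2) / 2)"
    unfolding w_def by (rule sum.swap)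
  also have "\<dots> \<le> (\<Sum>j<k. 1)"
  proof (rule sum_mono)
    fix j assume "j \<in> {..<k}"
    then have j: "j < k" by simp
    have "(\<Sum>i<n. (p j \<bullet> u i)\<^sup>2) = (\<Sum>i<n. (u i \<bullet> p j)\<^sup>2)"
      using comm_scalar_prod[OF pc(1)[OF j] uc(1)] by simp
    moreover have "(\<Sum>i<n. (q j \<bullet> v i)\<^sup>2) = (\<Sum>i<n. (v i \<bullet> q j)\<^sup>2)"
      using comm_scalar_prod[OF qc(1)[OF j] vc(1)] by simp
    ultimately show "(\<Sum>i<n. ((p j \<bullet> u i)\<^sup>2 + (q j \<bullet> v i)\<^sup>2) / 2) \<le> 1"
      using bessel_inequality[OF u pc(1)[OF j]] bessel_inequality[OF v qc(1)[OF j]] pc(2)[OF j] qc(2)[OF j]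
      by (simp add: sum.distrib sum_divide_distrib[symmetric])
  qed
  finally have wk: "(\<Sum>i<n. w i) \<le> real k" by simp
  have "(\<Sum>j<k. p j \<bullet> (X *\<^sub>v q j)) = (\<Sum>j<k. \<Sum>i<n. \<tau> i * ((p j \<bullet> u i) * (q j \<bullet> v i)))"
    by (simp add: expand)
  also have "\<dots> \<le> (\<Sum>j<k. \<Sum>i<n. \<tau> i * (((p j \<bullet> u i)\<^sup>2 + (q j \<bullet> v i)\<^sup>2) / 2))"
  proof (intro sum_mono mult_left_mono)
    fix i j
    show "(p j \<bullet> u i) * (q j \<bullet> v i) \<le> ((p j \<bullet> u i)\<^sup>2 + (q j \<bullet> v i)\<^sup>2) / 2"
      using sum_squares_bound[of "p j \<bullet> u i" "q j \<bullet> v i"] by simp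
  qed (use \<tau>(1) in simp)
  also have "\<dots> = (\<Sum>i<n. \<tau> i * w i)"
    unfolding w_def sum_distrib_left by (rule sum.swap)
  also have "\<dots> \<le> (\<Sum>i<k. \<tau> i)"
    by (rule weighted_sum_le_top_sum[OF \<tau> w0 w1 wk]) (use k in auto)
  also have "\<dots> = sum_list (take k (list_of_vec (singular_values X)))"
    using k by (simp add: sv take_map interv_sum_list_conv_sum_set_nat atLeast0LessThan)
  finally show ?thesis .
qed

text \<open>
  The singular vectors of the first \<open>k\<close> singular values attain the bound. If some of these values
  vanish, the corresponding left vectors are zero and contribute the correct value zero.
\<close>
lemma ky_fan_attained:
  assumes X: "X \<in> carrier_mat m n" and k: "k \<le> min m n"
  obtains p q where "unit_or_zero_family k m p" "unit_or_zero_family k n q"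
    "(\<Sum>j<k. p j \<bullet> (X *\<^sub>v q j)) = sum_list (take k (list_of_vec (singular_values X)))"
proof (rule singular_system[OF X])
  fix \<tau> u v
  assume v: "unit_or_zero_family n n v" and u: "unit_or_zero_family n m u"
    and Xv: "\<And>i. i < n \<Longrightarrow> X *\<^sub>v v i = \<tau> i \<cdot>\<^sub>v u i"
    and \<tau>u: "\<And>i. i < n \<Longrightarrow> \<tau> i * (u i \<bullet> u i) = \<tau> i"
    and sv: "list_of_vec (singular_values X) = map \<tau> [0..<min m n]"
  have "u j \<bullet> (X *\<^sub>v v j) = \<tau> j" if "j < k" for j
    using that k Xv[of j] \<tau>u[of j] u by (simp add: unit_or_zero_family_def)
  then have "(\<Sum>j<k. u j \<bullet> (X *\<^sub>v v j)) = (\<Sum>j<k. \<tau> j)" by simp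
  also have "\<dots> = sum_list (take k (list_of_vec (singular_values X)))"
    using k by (simp add: sv take_map interv_sum_list_conv_sum_set_nat atLeast0LessThan)
  finally show ?thesis
    using that unit_or_zero_family_antimono[OF u, of k] unit_or_zero_family_antimono[OF v, of k] k by simp
qed

definition orthogonal_average :: "real mat \<Rightarrow> real mat \<Rightarrow> real mat \<Rightarrow> real mat" where
  "orthogonal_average U V X = (1 / 2) \<cdot>\<^sub>m (X + U * X * V)"

text \<open>
  Test \<open>(X + U X V) / 2\<close> with families \<open>p\<close>, \<open>q\<close> that attain its Ky Fan sum. The value
  is the mean of the values of \<open>X\<close> at \<open>(p, q)\<close> and at \<open>(U\<^sup>T p, V q)\<close>, and each of these is at most the
  Ky Fan sum of \<open>X\<close>.
\<close>
theorem singular_values_orthogonal_average: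
  assumes X: "X \<in> carrier_mat m n" and U: "orthogonal_matrix m U" and V: "orthogonal_matrix n V"
  shows "weakly_majorized (min m n)
    (singular_values (orthogonal_average U V X)) (singular_values X)"
  unfolding weakly_majorized_def
proof
  fix k assume "k \<in> {1..min m n}"
  then have k: "k \<le> min m n" by simp
  have Uc: "U \<in> carrier_mat m m" and U1: "U\<^sup>T * U = 1\<^sub>m m"
    using U by (auto simp: orthogonal_matrix_def orthonormal_cols_def)
  have U2: "(U\<^sup>T)\<^sup>T * U\<^sup>T = 1\<^sub>m m" using mat_mult_left_right_inverse[OF _ Uc U1] Uc by simp
  have Vc: "V \<in> carrier_mat n n" and V1: "V\<^sup>T * V = 1\<^sub>m n"
    using V by (auto simp: orthogonal_matrix_def orthonormal_cols_def)
  let ?Y = "orthogonal_average U V X"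
  have Y: "?Y \<in> carrier_mat m n" using X Uc Vc by (simp add: orthogonal_average_def)
  obtain p q where p: "unit_or_zero_family k m p" and q: "unit_or_zero_family k n q"
    and top: "(\<Sum>j<k. p j \<bullet> (?Y *\<^sub>v q j)) = sum_list (take k (list_of_vec (singular_values ?Y)))"
    by (rule ky_fan_attained[OF Y k])
  have split: "p j \<bullet> (?Y *\<^sub>v q j) = (p j \<bullet> (X *\<^sub>v q j) + (U\<^sup>T *\<^sub>v p j) \<bullet> (X *\<^sub>v (V *\<^sub>v q j))) / 2"
    if "j < k" for j
  proof -
    have pj: "p j \<in> carrier_vec m" and qj: "q j \<in> carrier_vec n"
      using p q that by (auto simp: unit_or_zero_family_def)
    have UXV: "U * X * V \<in> carrier_mat m n" using X Uc Vc by simp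
    have "?Y *\<^sub>v q j = (1 / 2) \<cdot>\<^sub>v (X *\<^sub>v q j + (U * X * V) *\<^sub>v q j)"
      unfolding orthogonal_average_def using carrier_matD[OF X] carrier_matD[OF UXV] X UXV qj
      by (simp add: smult_mat_mult_vec add_mult_distrib_mat_vec[of _ m n])
    moreover have "(U * X * V) *\<^sub>v q j = U *\<^sub>v (X *\<^sub>v (V *\<^sub>v q j))"
      using X Uc Vc qj by (simp add: assoc_mult_mat_vec[of _ m n _ n] assoc_mult_mat_vec[of _ m m _ n] del: assoc_mult_mat)
    moreover have "p j \<bullet> (U *\<^sub>v (X *\<^sub>v (V *\<^sub>v q j))) = (U\<^sup>T *\<^sub>v p j) \<bullet> (X *\<^sub>v (V *\<^sub>v q j))"
      using X Uc Vc pj qj by (subst transpose_vec_mult_scalar[OF Uc]) auto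
    moreover have "X *\<^sub>v q j \<in> carrier_vec m" "U *\<^sub>v (X *\<^sub>v (V *\<^sub>v q j)) \<in> carrier_vec m"
      using X Uc Vc qj by auto
    ultimately show ?thesis using pj
      by (simp add: scalar_prod_add_distrib[of _ m])
  qed
  have "sum_list (take k (list_of_vec (singular_values ?Y)))
      = ((\<Sum>j<k. p j \<bullet> (X *\<^sub>v q j)) + (\<Sum>j<k. (U\<^sup>T *\<^sub>v p j) \<bullet> (X *\<^sub>v (V *\<^sub>v q j)))) / 2"
    unfolding top[symmetric] by (simp add: split sum.distrib sum_divide_distrib[symmetric])
  moreover have "(\<Sum>j<k. p j \<bullet> (X *\<^sub>v q j)) \<le> sum_list (take k (list_of_vec (singular_values X)))"
    by (rule ky_fan_upper_bound[OF X k p q])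
  moreover have "(\<Sum>j<k. (U\<^sup>T *\<^sub>v p j) \<bullet> (X *\<^sub>v (V *\<^sub>v q j)))
      \<le> sum_list (take k (list_of_vec (singular_values X)))"
    using Uc U2 by (intro ky_fan_upper_bound[OF X k] unit_or_zero_family_isometry[OF p]
        unit_or_zero_family_isometry[OF q Vc V1]) auto
  ultimately show "sum_list (take k (descending (list_of_vec (singular_values ?Y))))
      \<le> sum_list (take k (descending (list_of_vec (singular_values X))))"
    unfolding descending_singular_values[OF X] descending_singular_values[OF Y] by simp
qed

section \<open>Optimal solutions under orthogonal averages\<close>

text \<open>
  The setting in which averaging preserves optimality. How \<open>A\<close>, \<open>B\<close> and \<open>C\<close> are related to each other
  enters only through the intertwining conditions on the matrices used for the average.
\<close>
locale spectral_regularized_problem =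
  fixes r s m n :: nat and A B C :: "real mat" and c \<mu> :: real and N :: "real mat \<Rightarrow> real"
    and f g :: "real vec \<Rightarrow> ereal" and F G :: "real mat \<Rightarrow> ereal" and l :: "real \<Rightarrow> ereal"
  assumes A: "A \<in> carrier_mat r s" and B: "B \<in> carrier_mat r m" and C: "C \<in> carrier_mat n s"
    and mu: "0 \<le> \<mu>"
    and norm: "matrix_norm r s N" and ui: "unitarily_invariant r s N"
    and F: "\<And>X. X \<in> carrier_mat m n \<Longrightarrow> F X = f (singular_values X)"
    and G: "\<And>X. X \<in> carrier_mat m n \<Longrightarrow> G X = g (singular_values X)"
    and l_mono: "mono_on {0..} l"
    and f_mono: "weak_majorization_mono (min m n) f" and g_mono: "weak_majorization_mono (min m n) g"
begin

abbreviation optimal :: "real mat \<Rightarrow> bool" where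
  "optimal \<equiv> optimal_solution (feasible_set m n G c) (objective A B C N l \<mu> F)"

text \<open>
  The residual of the average is the mean of \<open>R = A - B X C\<close> and \<open>U' R V'\<close>, two matrices of equal norm,
  and the singular values of the average are weakly majorized by those of \<open>X\<close>. Hence no term of the objective
  and no constraint value increases.
\<close>
lemma optimal_orthogonal_average:
  assumes opt: "optimal X"
    and U: "orthogonal_matrix m U" and V: "orthogonal_matrix n V"
    and U': "orthogonal_matrix r U'" and V': "orthogonal_matrix s V'"
    and BU: "B * U = U' * B" and VC: "V * C = C * V'" and A_inv: "U' * A * V' = A"
  shows "optimal (orthogonal_average U V X)"
proof -
  let ?Y = "orthogonal_average U V X"
  have X: "X \<in> carrier_mat m n" and feas: "G X \<le> ereal c"
    using opt by (auto simp: optimal_solution_def feasible_set_def)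
  have carr: "U \<in> carrier_mat m m" "V \<in> carrier_mat n n" "U' \<in> carrier_mat r r" "V' \<in> carrier_mat s s"
    using U V U' V' by (auto simp: orthogonal_matrix_def)
  have dims [simp]: "dim_row U = m" "dim_col U = m" "dim_row V = n" "dim_col V = n"
    "dim_row U' = r" "dim_col U' = r" "dim_row V' = s" "dim_col V' = s"
    "dim_row X = m" "dim_col X = n" "dim_row A = r" "dim_col A = s"
    "dim_row B = r" "dim_col B = m" "dim_row C = n" "dim_col C = s"
    using carr X A B C by auto
  have Y: "?Y \<in> carrier_mat m n" using X carr by (simp add: orthogonal_average_def)
  have maj: "weakly_majorized (min m n) (singular_values ?Y) (singular_values X)"
    by (rule singular_values_orthogonal_average[OF X U V])
  note nonneg = singular_values_nonneg[OF X] singular_values_nonneg[OF Y]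
  have "G ?Y \<le> G X"
    using g_mono maj nonneg unfolding weak_majorization_mono_def G[OF X] G[OF Y] by blast
  then have feasible: "?Y \<in> feasible_set m n G c"
    using feas Y by (auto simp: feasible_set_def)
  have "F ?Y \<le> F X"
    using f_mono maj nonneg unfolding weak_majorization_mono_def F[OF X] F[OF Y] by blast
  then have F_le: "ereal \<mu> * F ?Y \<le> ereal \<mu> * F X"
    using mu by (simp add: ereal_mult_left_mono)
  define R where "R = A - B * X * C"
  have R: "R \<in> carrier_mat r s" unfolding R_def by (rule carrier_matI) simp_all
  then have dR [simp]: "dim_row R = r" "dim_col R = s" by auto
  have "U' * R * V' = A - B * (U * X * V) * C"
  proof -
    have "U' * R * V' = U' * A * V' - U' * B * X * (C * V')"
      by (simp add: R_def mat_ring_simps)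
    also have "\<dots> = A - B * (U * X * V) * C"
      unfolding A_inv BU[symmetric] VC[symmetric] by (simp add: assoc_mult_mat_dim)
    finally show ?thesis .
  qed
  moreover have "A - B * ?Y * C = (1 / 2) \<cdot>\<^sub>m (A - B * X * C) + (1 / 2) \<cdot>\<^sub>m (A - B * (U * X * V) * C)"
  proof -
    define P where "P = B * X * C"
    define Q where "Q = B * (U * X * V) * C"
    have [simp]: "dim_row P = r" "dim_col P = s" "dim_row Q = r" "dim_col Q = s"
      by (auto simp: P_def Q_def)
    have "B * ?Y * C = (1 / 2) \<cdot>\<^sub>m P + (1 / 2) \<cdot>\<^sub>m Q"
      by (simp add: orthogonal_average_def P_def Q_def mat_ring_simps)
    then show ?thesis unfolding P_def[symmetric] Q_def[symmetric]
      by (intro eq_matI) (auto simp: field_simps)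
  qed
  ultimately have residual: "A - B * ?Y * C = (1 / 2) \<cdot>\<^sub>m R + (1 / 2) \<cdot>\<^sub>m (U' * R * V')"
    by (simp only: R_def)
  have URV: "U' * R * V' \<in> carrier_mat r s" using carr R by simp
  have V'T: "orthogonal_matrix s (V'\<^sup>T)"
  proof -
    have "V'\<^sup>T * V' = 1\<^sub>m s" using V' by (simp add: orthogonal_matrix_def orthonormal_cols_def)
    then have "V' * V'\<^sup>T = 1\<^sub>m s" using mat_mult_left_right_inverse[OF _ carr(4)] carr(4) by simp
    then show ?thesis using carr(4) by (simp add: orthogonal_matrix_def orthonormal_cols_def)
  qed
  have "N (U' * R * (V'\<^sup>T)\<^sup>T) = N R"
    using ui R U' V'T unfolding unitarily_invariant_def by blast
  then have inv: "N (U' * R * V') = N R" by simp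
  have smul: "N (a \<cdot>\<^sub>m Z) = \<bar>a\<bar> * N Z" if "Z \<in> carrier_mat r s" for a Z
    using norm that by (simp add: matrix_norm_def)
  have "N (A - B * ?Y * C) \<le> N ((1 / 2) \<cdot>\<^sub>m R) + N ((1 / 2) \<cdot>\<^sub>m (U' * R * V'))"
    unfolding residual using norm R URV unfolding matrix_norm_def by (metis smult_carrier_mat)
  also have "\<dots> = N (A - B * X * C)"
    using smul[OF R] smul[OF URV] inv by (simp add: R_def)
  finally have N_le: "N (A - B * ?Y * C) \<le> N (A - B * X * C)" .
  moreover have "0 \<le> N (A - B * ?Y * C)"
  proof -
    have "A - B * ?Y * C \<in> carrier_mat r s" using carrier_matD[OF Y] by (intro carrier_matI) simp_all
    then show ?thesis using norm unfolding matrix_norm_def by blast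
  qed
  ultimately have "l (N (A - B * ?Y * C)) \<le> l (N (A - B * X * C))"
    using l_mono by (auto simp: mono_on_def)
  then have "objective A B C N l \<mu> F ?Y \<le> objective A B C N l \<mu> F X"
    unfolding objective_def using F_le by (rule add_mono)
  then show ?thesis
    using opt feasible unfolding optimal_solution_def by (meson order_trans)
qed

end

section \<open>Orthogonal matrices acting on the range of an isometry\<close>

lemma orthogonal_matrix_one: "orthogonal_matrix d (1\<^sub>m d)"
  by (simp add: orthogonal_matrix_def orthonormal_cols_def)

text \<open>
  For \<open>W\<close> with orthonormal columns this is the map that acts as \<open>\<epsilon> + E\<close> on the range of \<open>W\<close>, in the
  coordinates given by \<open>W\<close>, and as \<open>\<epsilon>\<close> on the orthogonal complement. Both the reflections in the range of \<open>W\<close>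
  (\<open>\<epsilon> = -1\<close>, \<open>E = 2\<close>) and the sign flips of single columns of \<open>W\<close> (\<open>\<epsilon> = 1\<close>) have this form.
\<close>
definition isometric_lift :: "real mat \<Rightarrow> real mat \<Rightarrow> real \<Rightarrow> real mat" where
  "isometric_lift W E \<epsilon> = \<epsilon> \<cdot>\<^sub>m 1\<^sub>m (dim_row W) + W * E * W\<^sup>T"

text \<open>
  The condition on the square of \<open>E\<close> says \<open>(\<epsilon> + E)\<^sup>2 = \<epsilon>\<^sup>2\<close>, so the lift is a symmetric involution.
\<close>
lemma orthogonal_isometric_lift:
  assumes W: "W \<in> carrier_mat d k" "orthonormal_cols W"
    and E: "E \<in> carrier_mat k k" "E\<^sup>T = E" "E * E = (- 2 * \<epsilon>) \<cdot>\<^sub>m E" and \<epsilon>: "\<epsilon> * \<epsilon> = 1"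
  shows "orthogonal_matrix d (isometric_lift W E \<epsilon>)"
proof -
  let ?L = "isometric_lift W E \<epsilon>"
  have [simp]: "dim_row W = d" "dim_col W = k" "dim_row E = k" "dim_col E = k" using W E by auto
  have WW: "W\<^sup>T * W = 1\<^sub>m k" using W by (simp add: orthonormal_cols_def)
  have L: "?L \<in> carrier_mat d d" using W E by (simp add: isometric_lift_def)
  have "(W * E * W\<^sup>T)\<^sup>T = W * E * W\<^sup>T"
    by (simp add: transpose_mult_dim E assoc_mult_mat_dim)
  moreover have "?L\<^sup>T = \<epsilon> \<cdot>\<^sub>m 1\<^sub>m d + (W * E * W\<^sup>T)\<^sup>T"
    by (rule eq_matI) (auto simp: isometric_lift_def simp del: index_mult_mat(1))
  ultimately have LT: "?L\<^sup>T = ?L" by (simp add: isometric_lift_def)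
  have "(W * E * W\<^sup>T) * (W * E * W\<^sup>T) = W * (E * E) * W\<^sup>T"
    by (simp add: assoc_mult_mat_dim left_mult_cancel_dim[OF WW])
  then have sq: "(W * E * W\<^sup>T) * (W * E * W\<^sup>T) = (- 2 * \<epsilon>) \<cdot>\<^sub>m (W * E * W\<^sup>T)"
    by (simp add: E mult_smult_dim)
  define Z where "Z = W * E * W\<^sup>T"
  have [simp]: "dim_row Z = d" "dim_col Z = d" by (auto simp: Z_def)
  have "?L * ?L = (\<epsilon> \<cdot>\<^sub>m 1\<^sub>m d + Z) * (\<epsilon> \<cdot>\<^sub>m 1\<^sub>m d + Z)" by (simp add: isometric_lift_def Z_def)
  also have "\<dots> = \<epsilon> \<cdot>\<^sub>m (\<epsilon> \<cdot>\<^sub>m 1\<^sub>m d) + \<epsilon> \<cdot>\<^sub>m Z + (\<epsilon> \<cdot>\<^sub>m Z + Z * Z)"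
    by (simp add: mat_ring_simps)
  also have "\<dots> = 1\<^sub>m d"
    unfolding sq[folded Z_def]
    by (rule eq_matI) (auto simp: \<epsilon>)
  finally show ?thesis using L LT by (simp add: orthogonal_matrix_def orthonormal_cols_def)
qed

text \<open>
  For \<open>X = B\<close> this moves an action on the unknown to the left of the residual. For \<open>X = C\<close>, read from
  right to left, it moves an action on the unknown to the right of the residual.
\<close>
lemma isometric_lift_intertwine:
  assumes X: "X = U * S * V\<^sup>T" and U: "U \<in> carrier_mat d k" "orthonormal_cols U"
    and V: "V \<in> carrier_mat d' k" "orthonormal_cols V"
    and S: "S \<in> carrier_mat k k" and E: "E \<in> carrier_mat k k" "S * E = E * S"
  shows "X * isometric_lift V E \<epsilon> = isometric_lift U E \<epsilon> * X"
proof -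
  have [simp]: "dim_row U = d" "dim_col U = k" "dim_row V = d'" "dim_col V = k"
    "dim_row S = k" "dim_col S = k" "dim_row E = k" "dim_col E = k" using U V S E by auto
  have UU: "U\<^sup>T * U = 1\<^sub>m k" and VV: "V\<^sup>T * V = 1\<^sub>m k" using U V by (auto simp: orthonormal_cols_def)
  have "X * isometric_lift V E \<epsilon> = \<epsilon> \<cdot>\<^sub>m X + U * (S * E) * V\<^sup>T"
    by (simp add: X isometric_lift_def mat_ring_simps left_mult_cancel_dim[OF VV])
  moreover have "isometric_lift U E \<epsilon> * X = \<epsilon> \<cdot>\<^sub>m X + U * (E * S) * V\<^sup>T"
    by (simp add: X isometric_lift_def mat_ring_simps left_mult_cancel_dim[OF UU])
  ultimately show ?thesis using E by simp
qed

text \<open>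
  The value \<open>-2\<close> makes \<open>1 + coordinate_flip d k\<close> the diagonal sign matrix whose only entry \<open>-1\<close>
  is at position \<open>k\<close>. For \<open>k \<ge> d\<close> it is the identity, so that rows and columns can be
  treated uniformly when their numbers differ.
\<close>
definition coordinate_flip :: "nat \<Rightarrow> nat \<Rightarrow> real mat" where
  "coordinate_flip d k = mat d d (\<lambda>(i, j). if i = j \<and> i = k then - 2 else 0)"

lemma coordinate_flip [simp]:
  "coordinate_flip d k \<in> carrier_mat d d" "dim_row (coordinate_flip d k) = d"
  "dim_col (coordinate_flip d k) = d" "diagonal_mat (coordinate_flip d k)"
  "(coordinate_flip d k)\<^sup>T = coordinate_flip d k"
  by (auto simp: coordinate_flip_def diagonal_mat_def)

lemma coordinate_flip_square:
  "coordinate_flip d k * coordinate_flip d k = (- 2 * 1) \<cdot>\<^sub>m coordinate_flip d k"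
proof (rule eq_matI)
  fix i j assume "i < dim_row ((- 2 * 1) \<cdot>\<^sub>m coordinate_flip d k)" "j < dim_col ((- 2 * 1) \<cdot>\<^sub>m coordinate_flip d k)"
  then have ij: "i < d" "j < d" by auto
  then show "(coordinate_flip d k * coordinate_flip d k) $$ (i, j) = ((- 2 * 1) \<cdot>\<^sub>m coordinate_flip d k) $$ (i, j)"
    using index_mult_diagonal_left[of "coordinate_flip d k" d "coordinate_flip d k" d i j]
    by (simp del: index_mult_mat(1)) (auto simp: coordinate_flip_def)
qed auto

lemma flip_conjugation_index:
  assumes Y: "Y \<in> carrier_mat a b" and ij: "i < a" "j < b"
  shows "((1\<^sub>m a + coordinate_flip a k) * Y * (1\<^sub>m b + coordinate_flip b k)) $$ (i, j)
    = (if (i = k) \<noteq> (j = k) then - Y $$ (i, j) else Y $$ (i, j))"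
proof -
  let ?J = "\<lambda>d. 1\<^sub>m d + coordinate_flip d k"
  have J: "?J d \<in> carrier_mat d d" "diagonal_mat (?J d)" for d
    by (auto simp: diagonal_mat_def coordinate_flip_def)
  have Jii: "?J d $$ (i, i) = (if i = k then - 1 else 1)" if "i < d" for d i
    using that by (simp add: coordinate_flip_def)
  have JY: "?J a * Y \<in> carrier_mat a b" using mult_carrier_mat[OF J(1) Y] .
  show ?thesis
    unfolding index_mult_diagonal_right[OF J JY ij] index_mult_diagonal_left[OF J Y ij] Jii[OF ij(1)] Jii[OF ij(2)]
    by simp
qed

text \<open>
  The flips reverse the sign of exactly those entries for which one of the two indices is \<open>k\<close>
  and the other is not; the average cancels them.
\<close>
lemma flip_average_index:
  assumes Y: "Y \<in> carrier_mat a b" and ij: "i < a" "j < b"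
  shows "orthogonal_average (1\<^sub>m a + coordinate_flip a k) (1\<^sub>m b + coordinate_flip b k) Y $$ (i, j)
    = (if (i = k) \<noteq> (j = k) then 0 else Y $$ (i, j))"
proof -
  have "orthogonal_average (1\<^sub>m a + coordinate_flip a k) (1\<^sub>m b + coordinate_flip b k) Y $$ (i, j)
    = (Y $$ (i, j) + ((1\<^sub>m a + coordinate_flip a k) * Y * (1\<^sub>m b + coordinate_flip b k)) $$ (i, j)) / 2"
    using ij carrier_matD[OF Y] by (simp add: orthogonal_average_def del: index_mult_mat(1) assoc_mult_mat)
  then show ?thesis unfolding flip_conjugation_index[OF assms]
    by (cases "i = k"; cases "j = k") simp_all
qed

text \<open>
  If \<open>A\<close> maps the range of \<open>V\<close> into that of \<open>U\<close> and \<open>A\<^sup>T\<close> maps the range of \<open>U\<close> into that of \<open>V\<close>, then \<open>A\<close> is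
  block diagonal with respect to these ranges and their complements, and \<open>T\<close> is the block on which the lifts act
  nontrivially.
\<close>
lemma isometric_lift_fixes:
  assumes U: "U \<in> carrier_mat r a" and V: "V \<in> carrier_mat s b" and A: "A \<in> carrier_mat r s"
    and T: "T \<in> carrier_mat a b" and UA: "U\<^sup>T * A = T * V\<^sup>T" and AV: "A * V = U * T"
    and D: "D \<in> carrier_mat a a" and E: "E \<in> carrier_mat b b"
    and fixed: "(1\<^sub>m a + D) * T * (1\<^sub>m b + E) = T" 
    and UU: "U\<^sup>T * U = 1\<^sub>m a" and VV: "V\<^sup>T * V = 1\<^sub>m b"
  shows "isometric_lift U D 1 * A * isometric_lift V E 1 = A"
proof -
  have [simp]: "dim_row U = r" "dim_col U = a" "dim_row V = s" "dim_col V = b" "dim_row A = r"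
    "dim_col A = s" "dim_row T = a" "dim_col T = b" "dim_row D = a" "dim_col D = a" "dim_row E = b"
    "dim_col E = b" using assms by auto
  define Q where "Q = T * E + D * T + D * T * E"
  have [simp]: "dim_row Q = a" "dim_col Q = b" by (auto simp: Q_def)
  have "T + Q = T"
    by (subst (2) fixed[symmetric], unfold Q_def)
      (simp add: mat_ring_simps, rule eq_matI, auto simp del: index_mult_mat(1))
  have "Q = 0\<^sub>m a b"
  proof (rule eq_matI)
    fix i j assume "i < dim_row (0\<^sub>m a b :: real mat)" "j < dim_col (0\<^sub>m a b :: real mat)"
    then show "Q $$ (i, j) = 0\<^sub>m a b $$ (i, j)"
      using arg_cong[OF \<open>T + Q = T\<close>, of "\<lambda>M. M $$ (i, j)"] by simp
  qed auto
  have AV': "A * (V * Z) = U * (T * Z)" if "dim_row Z = b" for Z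
    using that by (simp add: assoc_mult_mat_dim[symmetric] AV)
  have "isometric_lift U D 1 * A * isometric_lift V E 1 = A + U * (T * E) * V\<^sup>T + U * (D * T) * V\<^sup>T + U * (D * T * E) * V\<^sup>T"
    by (simp add: isometric_lift_def smult_one_mat_real mat_ring_simps UA AV' left_mult_cancel_dim[OF UU]
        left_mult_cancel_dim[OF VV])
      (rule eq_matI, auto simp del: index_mult_mat(1))
  also have "\<dots> = A + U * Q * V\<^sup>T"
    by (simp add: Q_def mat_ring_simps) (rule eq_matI, auto simp del: index_mult_mat(1))
  also have "\<dots> = A"
    unfolding \<open>Q = 0\<^sub>m a b\<close> using right_add_zero_mat[OF A] by simp
  finally show ?thesis .
qed

text \<open>
  On matrices supported on the ranges of \<open>V\<close> and \<open>W\<close>, averaging with lifts is averaging of the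
  coefficient matrix.
\<close>
lemma orthogonal_average_isometric_lift:
  assumes V: "V \<in> carrier_mat m a" "V\<^sup>T * V = 1\<^sub>m a" and W: "W \<in> carrier_mat n b" "W\<^sup>T * W = 1\<^sub>m b"
    and Y: "Y \<in> carrier_mat a b" and D: "D \<in> carrier_mat a a" and E: "E \<in> carrier_mat b b"
  shows "orthogonal_average (isometric_lift V D 1) (isometric_lift W E 1) (V * Y * W\<^sup>T)
    = V * orthogonal_average (1\<^sub>m a + D) (1\<^sub>m b + E) Y * W\<^sup>T"
proof -
  have [simp]: "dim_row V = m" "dim_col V = a" "dim_row W = n" "dim_col W = b" "dim_row Y = a"
    "dim_col Y = b" "dim_row D = a" "dim_col D = a" "dim_row E = b" "dim_col E = b" using assms by auto
  have "isometric_lift V D 1 * (V * Y * W\<^sup>T) * isometric_lift W E 1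
      = V * ((1\<^sub>m a + D) * Y * (1\<^sub>m b + E)) * W\<^sup>T"
    by (simp add: isometric_lift_def smult_one_mat_real mat_ring_simps left_mult_cancel_dim[OF V(2)]
        left_mult_cancel_dim[OF W(2)])
  then show ?thesis
    by (simp only: orthogonal_average_def) (simp add: mult_smult_dim mult_add_distrib_dim assoc_mult_mat_dim)
qed

lemma orthogonal_projection_reflection:
  assumes "V \<in> carrier_mat m a" "orthonormal_cols V"
  shows "orthogonal_matrix m (isometric_lift V (2 \<cdot>\<^sub>m 1\<^sub>m a) (- 1))"
  by (rule orthogonal_isometric_lift[OF assms]) (auto simp: mult_smult_dim intro!: eq_matI)

lemma orthogonal_average_projection:
  assumes V: "V \<in> carrier_mat m a" and X: "X \<in> carrier_mat m n"
  shows "orthogonal_average (isometric_lift V (2 \<cdot>\<^sub>m 1\<^sub>m a) (- 1)) (1\<^sub>m n) X = V * V\<^sup>T * X"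
proof -
  have [simp]: "dim_row V = m" "dim_col V = a" "dim_row X = m" "dim_col X = n" using assms by auto
  show ?thesis
    by (simp add: orthogonal_average_def isometric_lift_def mat_ring_simps)
      (rule eq_matI, auto simp del: index_mult_mat(1))
qed

lemma orthogonal_average_projection_right:
  assumes V: "V \<in> carrier_mat n a" and X: "X \<in> carrier_mat m n"
  shows "orthogonal_average (1\<^sub>m m) (isometric_lift V (2 \<cdot>\<^sub>m 1\<^sub>m a) (- 1)) X = X * (V * V\<^sup>T)"
proof -
  have [simp]: "dim_row V = n" "dim_col V = a" "dim_row X = m" "dim_col X = n" using assms by auto
  show ?thesis
    by (simp add: orthogonal_average_def isometric_lift_def mat_ring_simps)
      (rule eq_matI, auto simp del: index_mult_mat(1))
qed

section \<open>Thin singular value decompositions\<close>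

lemma thin_svdD:
  assumes "thin_svd k X U S V" "X \<in> carrier_mat d d'"
  shows "X = U * S * V\<^sup>T" "U \<in> carrier_mat d k" "orthonormal_cols U" "V \<in> carrier_mat d' k"
    "orthonormal_cols V" "S \<in> carrier_mat k k" "diagonal_mat S" "\<forall>i<k. S $$ (i, i) \<noteq> 0"
proof -
  show S: "S \<in> carrier_mat k k" using assms by (simp add: thin_svd_def)
  show "\<forall>i<k. S $$ (i, i) \<noteq> 0"
  proof (intro allI impI)
    fix i assume "i < k"
    then have "S $$ (i, i) \<in> set (diag_mat S)" using S by (auto simp: diag_mat_def)
    also have "set (diag_mat S) = set (filter (\<lambda>x. 0 < x) (list_of_vec (singular_values X)))"
      using assms(1) by (simp add: thin_svd_def)
    finally show "S $$ (i, i) \<noteq> 0" by simp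
  qed
qed (use assms in \<open>auto simp: thin_svd_def\<close>)

text \<open>
  Every column of \<open>U\<close> lies in the column space, because \<open>S\<close> has nonzero diagonal entries, and
  hence is orthogonal to all \<open>x - P x\<close>; this gives \<open>U\<^sup>T P = U\<^sup>T\<close>. Conversely \<open>U U\<^sup>T\<close> fixes the column
  space, hence \<open>U U\<^sup>T P = P\<close>.
\<close>
lemma orthogonal_projector_svd:
  assumes X: "X = U * S * V\<^sup>T" and U: "U \<in> carrier_mat d k" "orthonormal_cols U"
    and V: "V \<in> carrier_mat d' k" "orthonormal_cols V"
    and S: "S \<in> carrier_mat k k" "diagonal_mat S" "\<forall>i<k. S $$ (i, i) \<noteq> 0"
    and P: "orthogonal_projector d (vec_space.col_space d X) P"
  shows "P = U * U\<^sup>T"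
proof -
  have [simp]: "dim_row U = d" "dim_col U = k" "dim_row V = d'" "dim_col V = k"
    "dim_row S = k" "dim_col S = k" using U V S by auto
  have UU: "U\<^sup>T * U = 1\<^sub>m k" and VV: "V\<^sup>T * V = 1\<^sub>m k" using U V by (auto simp: orthonormal_cols_def)
  have Xc: "X \<in> carrier_mat d d'" by (auto simp: X)
  have W: "vec_space.col_space d X = {y \<in> carrier_vec d. \<exists>x\<in>carrier_vec d'. X *\<^sub>v x = y}"
    using vec_space.col_space_eq[OF Xc] Xc by simp
  have Pc: "P \<in> carrier_mat d d" using P by (simp add: orthogonal_projector_def)
  then have [simp]: "dim_row P = d" "dim_col P = d" by auto
  have UUT_fix: "U * U\<^sup>T * X = X"
    by (simp add: X assoc_mult_mat_dim left_mult_cancel_dim[OF UU])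
  have col_in: "col U j \<in> vec_space.col_space d X" if j: "j < k" for j
  proof -
    define x where "x = (1 / S $$ (j, j)) \<cdot>\<^sub>v col V j"
    have x: "x \<in> carrier_vec d'" by (auto simp: x_def intro: carrier_vecI)
    have "X * V = U * S" by (simp add: X assoc_mult_mat_dim VV)
    then have "X *\<^sub>v col V j = col (U * S) j"
      using col_mult2[OF Xc V(1) j] by simp
    also have "\<dots> = S $$ (j, j) \<cdot>\<^sub>v col U j"
    proof (rule eq_vecI)
      fix i assume "i < dim_vec (S $$ (j, j) \<cdot>\<^sub>v col U j)"
      then have i: "i < d" by simp
      show "col (U * S) j $ i = (S $$ (j, j) \<cdot>\<^sub>v col U j) $ i"
        using i j index_mult_diagonal_right[OF S(1,2), of U d i j] U(1) by (simp del: index_mult_mat(1) add: index_col)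
    qed simp
    finally have "X *\<^sub>v x = col U j"
      using S(3) j V(1) by (simp add: x_def mult_mat_vec[OF Xc] smult_smult_assoc)
    then show ?thesis using x U(1) j unfolding W by auto
  qed
  have UTP: "U\<^sup>T * P = U\<^sup>T"
  proof (rule eq_matI)
    fix j i assume "j < dim_row U\<^sup>T" "i < dim_col U\<^sup>T"
    then have j: "j < k" and i: "i < d" by auto
    let ?e = "unit_vec d i"
    have Pe: "P *\<^sub>v ?e = col P i" using Pc i by (simp add: mult_mat_unit_vec)
    have "(?e - P *\<^sub>v ?e) \<bullet> col U j = 0"
      using P col_in[OF j] unfolding orthogonal_projector_def by simp
    moreover have "(?e - col P i) \<bullet> col U j = ?e \<bullet> col U j - col P i \<bullet> col U j"
      by (rule minus_scalar_prod_distrib[of _ d]) (rule carrier_vecI, simp)+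
    moreover have "col P i \<bullet> col U j = col U j \<bullet> col P i"
      by (rule comm_scalar_prod[of _ d]) (rule carrier_vecI, simp)+
    moreover have "?e \<bullet> col U j = U $$ (i, j)"
      using scalar_prod_left_unit[of "col U j" d i] i j by (simp add: carrier_vecI)
    ultimately have "col U j \<bullet> col P i = U $$ (i, j)"
      unfolding Pe using i j by simp
    then show "(U\<^sup>T * P) $$ (j, i) = U\<^sup>T $$ (j, i)" using i j by simp
  qed auto
  have "U * U\<^sup>T * P = P"
  proof (rule eq_matI)
    fix i j assume "i < dim_row P" "j < dim_col P"
    then have i: "i < d" and j: "j < d" by auto
    have "P *\<^sub>v unit_vec d j \<in> vec_space.col_space d X"
      using P unfolding orthogonal_projector_def by simp
    then obtain x where x: "x \<in> carrier_vec d'" "X *\<^sub>v x = col P j"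
      using Pc j unfolding W by (auto simp: mult_mat_unit_vec)
    have "col (U * U\<^sup>T * P) j = (U * U\<^sup>T) *\<^sub>v (X *\<^sub>v x)"
      unfolding x(2) by (rule col_mult2[OF _ Pc j]) auto
    also have "\<dots> = (U * U\<^sup>T * X) *\<^sub>v x"
      using Xc x by (subst assoc_mult_mat_vec[of _ d d _ d']) auto
    also have "\<dots> = col P j" unfolding UUT_fix x(2) ..
    finally show "(U * U\<^sup>T * P) $$ (i, j) = P $$ (i, j)"
      using i j by (metis Pc \<open>dim_col P = d\<close> \<open>dim_row P = d\<close> \<open>dim_row U = d\<close> index_col index_mult_mat(2,3))
  qed auto
  moreover have "U * U\<^sup>T * P = U * U\<^sup>T" by (simp add: assoc_mult_mat_dim UTP)
  ultimately show ?thesis by simp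
qed

section \<open>Existence of a diagonal optimal solution\<close>

theorem proposition3p7:
  fixes r s m n q r_b r_c :: nat
    and A B C P_B P_C U_B S_B V_B U_C S_C V_C :: "real mat"
    and c \<mu> :: real
    and N :: "real mat \<Rightarrow> real"
    and F G :: "real mat \<Rightarrow> ereal"
    and f g :: "real vec \<Rightarrow> ereal"
    and l :: "real \<Rightarrow> ereal"
  assumes A: "A \<in> carrier_mat r s" and B: "B \<in> carrier_mat r m" and C: "C \<in> carrier_mat n s"
    and mu: "\<mu> \<ge> 0"
    and q: "q = min m n" and r_b: "r_b = vec_space.rank r B" and r_c: "r_c = vec_space.rank n C"
    and norm: "matrix_norm r s N" and ui: "unitarily_invariant r s N"
    and F: "\<And>X. X \<in> carrier_mat m n \<Longrightarrow> F X = f (singular_values X)"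
    and G: "\<And>X. X \<in> carrier_mat m n \<Longrightarrow> G X = g (singular_values X)"
    and f: "proper_on (carrier_vec q) f" "absolutely_symmetric q f"
    and g: "proper_on (carrier_vec q) g" "absolutely_symmetric q g"
    and l: "proper_on {0..} l" "mono_on {0..} l"
    and f_mono: "weak_majorization_mono q f" and g_mono: "weak_majorization_mono q g"
    and P_B: "orthogonal_projector r (vec_space.col_space r B) P_B"
    and P_C: "orthogonal_projector s (vec_space.row_space s C) P_C"
    and iv: "(1\<^sub>m r - P_B) * A * P_C = 0\<^sub>m r s" "P_B * A * (1\<^sub>m s - P_C) = 0\<^sub>m r s"
    and svd_B: "thin_svd r_b B U_B S_B V_B" and svd_C: "thin_svd r_c C U_C S_C V_C"
    and A_tilde: "diagonal_mat (U_B\<^sup>T * A * V_C)"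
    and solvable: "\<exists>X. optimal_solution (feasible_set m n G c) (objective A B C N l \<mu> F) X"
  shows "\<exists>\<Sigma> \<in> carrier_mat r_b r_c. diagonal_mat \<Sigma> \<and>
    optimal_solution (feasible_set m n G c) (objective A B C N l \<mu> F) (V_B * \<Sigma> * U_C\<^sup>T)"
proof -
  interpret spectral_regularized_problem r s m n A B C c \<mu> N f g F G l
    using A B C mu norm ui F G l f_mono g_mono unfolding q by unfold_locales auto
  note B_svd = thin_svdD[OF svd_B B] and C_svd = thin_svdD[OF svd_C C]
  have dims [simp]: "dim_row A = r" "dim_col A = s" "dim_row B = r" "dim_col B = m" "dim_row C = n" "dim_col C = s"
    "dim_row U_B = r" "dim_col U_B = r_b" "dim_row V_B = m" "dim_col V_B = r_b"
    "dim_row S_B = r_b" "dim_col S_B = r_b" "dim_row U_C = n" "dim_col U_C = r_c"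
    "dim_row V_C = s" "dim_col V_C = r_c" "dim_row S_C = r_c" "dim_col S_C = r_c"
    using A B C B_svd C_svd by auto
  have UB: "U_B\<^sup>T * U_B = 1\<^sub>m r_b" and VB: "V_B\<^sup>T * V_B = 1\<^sub>m r_b"
    and UC: "U_C\<^sup>T * U_C = 1\<^sub>m r_c" and VC: "V_C\<^sup>T * V_C = 1\<^sub>m r_c"
    using B_svd C_svd by (auto simp: orthonormal_cols_def)
  have PB: "P_B = U_B * U_B\<^sup>T"
    by (rule orthogonal_projector_svd[OF B_svd P_B])
  have S_C_sym: "S_C\<^sup>T = S_C"
    by (rule eq_matI) (use C_svd(7) in \<open>auto simp: diagonal_mat_def, metis\<close>)
  have CT: "C\<^sup>T = V_C * S_C * U_C\<^sup>T"
    by (subst C_svd(1)) (simp add: transpose_mult_dim S_C_sym assoc_mult_mat_dim)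
  have PC: "P_C = V_C * V_C\<^sup>T"
    by (rule orthogonal_projector_svd[OF CT C_svd(4,5,2,3,6,7,8)])
      (use P_C in \<open>simp add: vec_space.row_space_eq_col_space_transpose\<close>)
  have [simp]: "dim_row P_B = r" "dim_col P_B = r" "dim_row P_C = s" "dim_col P_C = s"
    by (simp_all add: PB PC)
  define T where "T = U_B\<^sup>T * A * V_C"
  have T: "T \<in> carrier_mat r_b r_c" by (auto simp: T_def intro: carrier_matI)
  then have [simp]: "dim_row T = r_b" "dim_col T = r_c" by auto
  have mat_eqI: "X = Y" if "X - Y = 0\<^sub>m a b" "X \<in> carrier_mat a b" "Y \<in> carrier_mat a b"
    for X Y :: "real mat" and a b
  proof (rule eq_matI)
    fix i j assume "i < dim_row Y" "j < dim_col Y"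
    then show "X $$ (i, j) = Y $$ (i, j)"
      using arg_cong[OF that(1), of "\<lambda>M. M $$ (i, j)"] carrier_matD[OF that(2)] carrier_matD[OF that(3)]
      by simp
  qed (use carrier_matD[OF that(2)] carrier_matD[OF that(3)] in simp_all)
  \<comment> \<open>The conditions on \<open>P_B\<close>, \<open>A\<close> and \<open>P_C\<close>, in the coordinates of the singular vectors.\<close>
  have AV: "A * V_C = U_B * T"
  proof -
    have "(1\<^sub>m r - P_B) * A * P_C = A * P_C - P_B * A * P_C"
      by (simp add: mat_ring_simps)
    from this[symmetric, unfolded iv(1)] have "A * P_C = P_B * A * P_C"
      by (rule mat_eqI; intro carrier_matI; simp)
    then have "A * P_C * V_C = P_B * A * P_C * V_C" by simp
    then show ?thesis by (simp add: PB PC T_def assoc_mult_mat_dim VC)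
  qed
  have UA: "U_B\<^sup>T * A = T * V_C\<^sup>T"
  proof -
    have "P_B * A * (1\<^sub>m s - P_C) = P_B * A - P_B * A * P_C"
      by (simp add: mat_ring_simps)
    from this[symmetric, unfolded iv(2)] have "P_B * A = P_B * A * P_C"
      by (rule mat_eqI; intro carrier_matI; simp)
    then have "U_B\<^sup>T * (P_B * A) = U_B\<^sup>T * (P_B * A * P_C)" by simp
    moreover have "U_B\<^sup>T * (P_B * A) = U_B\<^sup>T * A"
      by (simp add: PB assoc_mult_mat_dim left_mult_cancel_dim[OF UB])
    moreover have "U_B\<^sup>T * (P_B * A * P_C) = T * V_C\<^sup>T"
      by (simp add: PB PC T_def assoc_mult_mat_dim left_mult_cancel_dim[OF UB])
    ultimately show ?thesis by simp
  qed
  obtain X where X: "optimal X" using solvable by auto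
  then have Xc: "X \<in> carrier_mat m n" by (simp add: optimal_solution_def feasible_set_def)
  \<comment> \<open>The components of \<open>X\<close> outside the row space of \<open>B\<close> and the column space of \<open>C\<close> are removed.\<close>
  have "optimal (V_B * V_B\<^sup>T * X)"
    unfolding orthogonal_average_projection[OF B_svd(4) Xc, symmetric]
  proof (rule optimal_orthogonal_average[OF X orthogonal_projection_reflection[OF B_svd(4,5)]
        orthogonal_matrix_one orthogonal_matrix_one orthogonal_matrix_one])
    show "B * isometric_lift V_B (2 \<cdot>\<^sub>m 1\<^sub>m r_b) (- 1) = 1\<^sub>m r * B"
      by (subst (1 2) B_svd(1)) (simp add: isometric_lift_def mat_ring_simps left_mult_cancel_dim[OF VB],
          rule eq_matI, auto simp del: index_mult_mat(1))
  qed auto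
  then have "optimal (V_B * V_B\<^sup>T * X * (U_C * U_C\<^sup>T))"
    unfolding orthogonal_average_projection_right[OF C_svd(2) mult_carrier_mat[OF mult_carrier_mat[OF B_svd(4) transpose_carrier_mat[THEN iffD2, OF B_svd(4)]] Xc], symmetric]
  proof (rule optimal_orthogonal_average[OF _ orthogonal_matrix_one
        orthogonal_projection_reflection[OF C_svd(2,3)] orthogonal_matrix_one orthogonal_matrix_one])
    show "isometric_lift U_C (2 \<cdot>\<^sub>m 1\<^sub>m r_c) (- 1) * C = C * 1\<^sub>m s"
      by (subst (1 2) C_svd(1)) (simp add: isometric_lift_def mat_ring_simps left_mult_cancel_dim[OF UC],
          rule eq_matI, auto simp del: index_mult_mat(1))
  qed auto
  then have start: "optimal (V_B * (V_B\<^sup>T * X * U_C) * U_C\<^sup>T)"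
    using carrier_matD[OF Xc] by (simp add: assoc_mult_mat_dim)
  \<comment> \<open>The off-diagonal entries are removed index by index.\<close>
  have pinch: "\<exists>Y \<in> carrier_mat r_b r_c. optimal (V_B * Y * U_C\<^sup>T) \<and>
      (\<forall>i<r_b. \<forall>j<r_c. i \<noteq> j \<and> (i < k \<or> j < k) \<longrightarrow> Y $$ (i, j) = 0)" for k
  proof (induction k)
    case 0
    have "V_B\<^sup>T * X * U_C \<in> carrier_mat r_b r_c" using Xc by (intro carrier_matI) auto
    then show ?case using start by auto
  next
    case (Suc k)
    then obtain Y where Y: "Y \<in> carrier_mat r_b r_c" "optimal (V_B * Y * U_C\<^sup>T)"
      and zero: "\<And>i j. i < r_b \<Longrightarrow> j < r_c \<Longrightarrow> i \<noteq> j \<Longrightarrow> i < k \<or> j < k \<Longrightarrow> Y $$ (i, j) = 0" by blast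
    let ?D = "coordinate_flip r_b k" and ?E = "coordinate_flip r_c k"
    let ?Y = "orthogonal_average (1\<^sub>m r_b + ?D) (1\<^sub>m r_c + ?E) Y"
    have fixed: "(1\<^sub>m r_b + ?D) * T * (1\<^sub>m r_c + ?E) = T"
    proof (rule eq_matI)
      fix i j assume "i < dim_row T" "j < dim_col T"
      then have ij: "i < r_b" "j < r_c" by auto
      show "((1\<^sub>m r_b + ?D) * T * (1\<^sub>m r_c + ?E)) $$ (i, j) = T $$ (i, j)"
        unfolding flip_conjugation_index[OF T ij]
        using A_tilde ij by (auto simp: T_def[symmetric] diagonal_mat_def)
    qed auto
    note lift = orthogonal_isometric_lift[where \<epsilon> = 1, OF _ _ coordinate_flip(1,5) coordinate_flip_square]
    have "optimal (orthogonal_average (isometric_lift V_B ?D 1) (isometric_lift U_C ?E 1) (V_B * Y * U_C\<^sup>T))"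
    proof (rule optimal_orthogonal_average[OF Y(2)])
      show "B * isometric_lift V_B ?D 1 = isometric_lift U_B ?D 1 * B"
        by (rule isometric_lift_intertwine[OF B_svd(1-6)])
          (auto intro!: diagonal_mat_commute[OF B_svd(6,7)])
      show "isometric_lift U_C ?E 1 * C = C * isometric_lift V_C ?E 1"
        by (rule isometric_lift_intertwine[OF C_svd(1-6), symmetric])
          (auto intro!: diagonal_mat_commute[OF C_svd(6,7)])
      show "isometric_lift U_B ?D 1 * A * isometric_lift V_C ?E 1 = A"
        by (rule isometric_lift_fixes[OF B_svd(2) C_svd(4) A T UA AV _ _ fixed UB VC]) auto
    qed (auto intro!: lift B_svd C_svd)
    then have "optimal (V_B * ?Y * U_C\<^sup>T)"
      by (subst (asm) orthogonal_average_isometric_lift[OF B_svd(4) VB C_svd(2) UC Y(1)]) auto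
    moreover have "?Y \<in> carrier_mat r_b r_c"
      using Y(1) by (auto simp: orthogonal_average_def intro!: carrier_matI)
    moreover have "?Y $$ (i, j) = 0" if "i < r_b" "j < r_c" "i \<noteq> j" "i < Suc k \<or> j < Suc k" for i j
      unfolding flip_average_index[OF Y(1) that(1,2)] using that zero[of i j] by (auto simp: less_Suc_eq)
    ultimately show ?case by blast
  qed
  from pinch[of r_b] obtain Y where "Y \<in> carrier_mat r_b r_c" "optimal (V_B * Y * U_C\<^sup>T)"
    and "\<forall>i<r_b. \<forall>j<r_c. i \<noteq> j \<longrightarrow> Y $$ (i, j) = 0" by blast
  then show ?thesis by (intro bexI[of _ Y]) (auto simp: diagonal_mat_def)
qed

end
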